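(* Let $J:=\operatorname{conv}\{\mathbf{v}_0,\mathbf{v}_1,\dots,\mathbf{v}_d\}\subset\mathbb{R}^d_{\ge0}\setminus\{\mathbf{0}\}$ be a $d$-simplex and let $f(\mathbf{x})=(\mathbf{c}^\top\mathbf{x})^q$ with $\mathbf{c}\neq\mathbf{0}$ and $q$ an even positive integer. Then $$\frac{\operatorname{vol}(P^0(f,J))-\operatorname{vol}(P(f,J))}{\operatorname{vol}(P^0(f,J))}\ge\frac{q-1}{\frac{(q+d+1)!}{q!\,(d+1)!}2^{q/2}(q/2)!-(d+2)}.$$
   Context: Let $\mu$ be the unique affine function agreeing with $f$ at the vertices of $J$ and $\mu(\mathbf{x},z):=z\mu(\mathbf{x}/z)$ (extended linearly in $(\mathbf{x},z)$). For $z\ge0$, $z\cdot J:=\{z\mathbf{x}:\mathbf{x}\in J\}$. Perspective relaxation: $P(f,J):=\operatorname{cl}\{(\mathbf{x},y,z)\in\mathbb{R}^d\times\mathbb{R}\times\mathbb{R}:\mu(\mathbf{x},z)\ge y\ge zf(\mathbf{x}/z),\ \mathbf{x}\in z\cdot J,\ 1\ge z>0\}$. Naive relaxation: $P^0(f,J):=\{(\mathbf{x},y,z)\in\mathbb{R}^d\times\mathbb{R}\times\mathbb{R}:\mu(\mathbf{x},z)\ge y\ge f(\mathbf{x}),\ \mathbf{x}\in z\cdot J,\ 1\ge z\ge0\}$. $\operatorname{vol}$ is $(d+2)$-dimensional Lebesgue measure. *)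

theory Defs
  imports "HOL-Analysis.Analysis"
begin

definition affine_interp_coef :: "(real^'n \<Rightarrow> real) \<Rightarrow> (real^'n) set \<Rightarrow> (real^'n) \<times> real" where
  "affine_interp_coef f V = (THE ab. \<forall>v\<in>V. fst ab \<bullet> v + snd ab = f v)"

text \<open>Homogenization mu(x,z) = z mu(x/z), extended linearly: a \<bullet> x + b z.\<close>
definition persp_mu :: "(real^'n \<Rightarrow> real) \<Rightarrow> (real^'n) set \<Rightarrow> real^'n \<Rightarrow> real \<Rightarrow> real" where
  "persp_mu f V x z = fst (affine_interp_coef f V) \<bullet> x + snd (affine_interp_coef f V) * z"

definition scale_set :: "real \<Rightarrow> (real^'n) set \<Rightarrow> (real^'n) set" where
  "scale_set z J = (\<lambda>x. z *\<^sub>R x) ` J"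

definition persp_relax :: "(real^'n \<Rightarrow> real) \<Rightarrow> (real^'n) set \<Rightarrow> (real^'n) set \<Rightarrow> ((real^'n) \<times> real \<times> real) set" where
  "persp_relax f V J = closure {(x, y, z). persp_mu f V x z \<ge> y \<and> y \<ge> z * f ((1 / z) *\<^sub>R x)
      \<and> x \<in> scale_set z J \<and> 0 < z \<and> z \<le> 1}"

definition naive_relax :: "(real^'n \<Rightarrow> real) \<Rightarrow> (real^'n) set \<Rightarrow> (real^'n) set \<Rightarrow> ((real^'n) \<times> real \<times> real) set" where
  "naive_relax f V J = {(x, y, z). persp_mu f V x z \<ge> y \<and> y \<ge> f x
      \<and> x \<in> scale_set z J \<and> 0 \<le> z \<and> z \<le> 1}"

end

theory Submission
  imports Defs "HOL-Probability.Probability"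
begin

text \<open>Let \<open>d\<close> be the dimension, \<open>A\<close> and \<open>B\<close> the integrals over \<open>J\<close> of \<open>f\<close> and of its affine
  interpolant. Integrating over horizontal slices, the naive and the perspective relaxation have
  volumes \<open>B / (d + 2) - A / (q + d + 1)\<close> and \<open>(B - A) / (d + 2)\<close>, so the claim becomes an upper
  bound for \<open>B / A\<close>. Weighting the cone over \<open>J\<close> by \<open>exp (- z)\<close> and
  mapping it linearly to an orthant expresses \<open>A\<close> through the moment of order \<open>q\<close> of
  \<open>\<Sum>v. (c \<bullet> v) * X v\<close> with independent standard exponential \<open>X v\<close>, which is \<open>q!\<close> times the
  complete homogeneous symmetric polynomial \<open>h q\<close> in the numbers \<open>c \<bullet> v\<close>; likewise \<open>B\<close> is given
  by the power sum of order \<open>q\<close>. The bound is then Hunter's inequality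
  \<open>h (2 * k) \<ge> (\<Sum>x\<^sup>2) ^ k / (2 ^ k * k!)\<close>. The Jacobian cancels, so it is only needed
  that a linear bijection scales Lebesgue measure by some positive constant.\<close>

section \<open>Complete homogeneous symmetric polynomials\<close>

text \<open>\<open>chs xs m\<close> is the complete homogeneous symmetric polynomial of degree \<open>m\<close> in the entries of \<open>xs\<close>.\<close>

fun chs :: "real list \<Rightarrow> nat \<Rightarrow> real" where
  "chs xs 0 = 1"
| "chs [] (Suc m) = 0"
| "chs (y # xs) (Suc m) = chs xs (Suc m) + y * chs (y # xs) m"

text \<open>With the generating function \<open>\<Prod> 1 / (1 - x * t)\<close> of
  \<open>chs\<close>, this is the partial fraction identity \<open>(y - z) * t / ((1 - y * t) * (1 -
  z * t)) = 1 / (1 - y * t) - 1 / (1 - z * t)\<close>. It yields symmetry here and the comparison of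
  derivatives in Hunter's inequality.\<close>

lemma chs_divided_difference:
  "(y - z) * chs (y # z # xs) m = chs (y # xs) (Suc m) - chs (z # xs) (Suc m)"
proof (induction m)
  case (Suc m)
  have "(y - z) * chs (y # z # xs) (Suc m) =
      (y - z) * chs (z # xs) (Suc m) + y * ((y - z) * chs (y # z # xs) m)"
    by (simp add: algebra_simps)
  also have "\<dots> = y * chs (y # xs) (Suc m) - z * chs (z # xs) (Suc m)"
    unfolding Suc.IH by (simp add: algebra_simps)
  finally show ?case by simp
qed simp

text \<open>The recursion singles out the head of the list, which hides the symmetry. For distinct
  \<open>y\<close> and \<open>z\<close>, exchanging them changes the sign of the right side of the
  divided difference identity.\<close>

lemma chs_swap: "chs (y # z # xs) m = chs (z # y # xs) m"
proof (cases "y = z")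
  case False
  have "(y - z) * chs (y # z # xs) m = (y - z) * chs (z # y # xs) m"
    using chs_divided_difference[of y z xs m] chs_divided_difference[of z y xs m]
    by (simp add: algebra_simps)
  with False show ?thesis by simp
qed simp

text \<open>Sorting the monomials by the exponent of \<open>y\<close> gives the shape that the
  binomial theorem produces for moments.\<close>

lemma chs_Cons_conv_sum: "chs (y # xs) m = (\<Sum>i\<le>m. y ^ i * chs xs (m - i))"
proof (induction m)
  case (Suc m)
  have "(\<Sum>i\<le>Suc m. y ^ i * chs xs (Suc m - i)) =
      chs xs (Suc m) + y * (\<Sum>i\<le>m. y ^ i * chs xs (m - i))"
    by (simp add: sum.atMost_Suc_shift sum_distrib_left mult.assoc del: sum.atMost_Suc)
  with Suc show ?case by simp
qed simp

lemma chs_1: "chs xs (Suc 0) = sum_list xs"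
  by (induction xs) auto

text \<open>Chain rule: the partial derivative of the polynomial of degree \<open>m + 1\<close> in
  one variable is the polynomial of degree \<open>m\<close> with that variable listed twice, because
  \<open>1 / (1 - x * s)\<close> has derivative \<open>s / (1 - x * s)^2\<close> in
  \<open>x\<close>.\<close>

lemma has_real_derivative_chs:
  assumes "\<And>x. x \<in> set xs \<Longrightarrow> ((\<lambda>t. g x t) has_real_derivative g' x) (at t)"
  shows "((\<lambda>t. chs (map (\<lambda>x. g x t) xs) (Suc m)) has_real_derivative
     (\<Sum>x\<leftarrow>xs. g' x * chs (g x t # map (\<lambda>x. g x t) xs) m)) (at t)"
  using assms
proof (induction xs arbitrary: m)
  case (Cons a xs)
  let ?ys = "\<lambda>t. map (\<lambda>x. g x t) xs"
  have g [derivative_intros]: "((\<lambda>t. g a t) has_real_derivative g' a) (at t)"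
    using Cons.prems by simp
  have D [derivative_intros]: "((\<lambda>t. chs (?ys t) (Suc m)) has_real_derivative
     (\<Sum>x\<leftarrow>xs. g' x * chs (g x t # ?ys t) m)) (at t)" for m
    using Cons.prems by (intro Cons.IH) auto
  show ?case
  proof (induction m)
    case 0
    show ?case by (auto intro!: derivative_eq_intros)
  next
    case (Suc m)
    note Suc.IH [derivative_intros]
    let ?y = "g a t"
    \<comment> \<open>Swapping on both sides brings \<open>?y\<close> to the head, where the
      equation is the defining recursion.\<close>
    have sw: "chs (g x t # ?y # ?ys t) (Suc m) =
        chs (g x t # ?ys t) (Suc m) + ?y * chs (g x t # ?y # ?ys t) m" for x
      by (subst (1 2) chs_swap) (simp del: chs.simps(1) add: chs.simps(3)[of ?y])
    have eq: "(\<Sum>x\<leftarrow>xs. g' x * chs (g x t # ?ys t) (Suc m)) +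
        (g' a * chs (?y # ?ys t) (Suc m) +
         (\<Sum>x\<leftarrow>a # xs. g' x * chs (g x t # ?y # ?ys t) m) * ?y) =
        (\<Sum>x\<leftarrow>a # xs. g' x * chs (g x t # ?y # ?ys t) (Suc m))"
      by (simp add: sw sum_list_addf sum_list_const_mult[symmetric] algebra_simps
          del: chs.simps)
    have "((\<lambda>t. chs (?ys t) (Suc (Suc m)) + g a t * chs (map (\<lambda>x. g x t) (a # xs)) (Suc m))
      has_real_derivative
        (\<Sum>x\<leftarrow>xs. g' x * chs (g x t # ?ys t) (Suc m)) +
        (g' a * chs (?y # ?ys t) (Suc m) +
         (\<Sum>x\<leftarrow>a # xs. g' x * chs (g x t # ?y # ?ys t) m) * ?y)) (at t)"
      using DERIV_add[OF D[of "Suc m"] DERIV_mult[OF g Suc.IH]] by (simp del: chs.simps)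
    then show ?case unfolding eq by simp
  qed
qed simp

text \<open>This is the ratio of consecutive values of \<open>a ^ m * (n + m - 1 choose m)\<close>,
  the number of monomials times their common value. The recurrence form avoids a truncated
  subtraction at \<open>n = 0\<close>.\<close>

lemma chs_replicate_rec:
  "real (Suc m) * chs (replicate n a) (Suc m) = real (n + m) * a * chs (replicate n a) m"
proof (induction n arbitrary: m)
  case (Suc n)
  note IH = Suc.IH
  let ?A = "chs (replicate n a)" and ?B = "chs (replicate (Suc n) a)"
  show ?case
  proof (induction m)
    case 0
    show ?case using IH[of 0] by (simp add: algebra_simps)
  next
    case (Suc m)
    have B: "?B (Suc j) = ?A (Suc j) + a * ?B j" for j by simp
    have "real (Suc (Suc m)) * ?B (Suc (Suc m)) =
        real (n + Suc m) * a * ?A (Suc m) + real (Suc (Suc m)) * a * ?B (Suc m)"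
      unfolding B[of "Suc m"] distrib_left IH by (simp add: mult.assoc)
    also have "?A (Suc m) = ?B (Suc m) - a * ?B m"
      by (simp add: B[of m])
    also have "real (n + Suc m) * a * (?B (Suc m) - a * ?B m) =
        real (n + Suc m) * a * ?B (Suc m) - a * (real (Suc n + m) * a * ?B m)"
      by (simp add: algebra_simps del: chs.simps replicate_Suc)
    also have "real (Suc n + m) * a * ?B m = real (Suc m) * ?B (Suc m)"
      using Suc.IH by simp
    finally show ?case by (simp add: algebra_simps del: chs.simps replicate_Suc)
  qed
next
  case 0
  show ?case by (cases m) simp_all
qed

text \<open>Two steps of the recurrence multiply the right side by \<open>(n + 2 * k + 1) * (n + 2 *
  k) * a^2 / ((2 * k + 2) * (2 * k + 1))\<close>. This is at least
  \<open>n * a^2 / (2 * k + 2)\<close>, the factor gained on the left. The result is the starting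
  point of the segment in the general inequality.\<close>

lemma hunter_replicate:
  "(real n * a\<^sup>2) ^ k / (2 ^ k * fact k) \<le> chs (replicate n a) (2 * k)"
proof (induction k)
  case (Suc k)
  let ?h = "chs (replicate n a)"
  have nn: "0 \<le> ?h (2 * k)"
    by (rule order_trans[OF _ Suc.IH]) simp
  have "real (2 * k + 2) * (real (2 * k + 1) * ?h (2 * Suc k)) =
      real (2 * k + 1) * (real (n + 2 * k + 1) * a * ?h (Suc (2 * k)))"
    using chs_replicate_rec[of "Suc (2 * k)" n a] by (simp add: algebra_simps)
  also have "\<dots> = real (n + 2 * k + 1) * a * (real (2 * k + 1) * ?h (Suc (2 * k)))"
    by (simp add: algebra_simps)
  also have "real (2 * k + 1) * ?h (Suc (2 * k)) = real (n + 2 * k) * a * ?h (2 * k)"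
    using chs_replicate_rec[of "2 * k" n a] by simp
  finally have rec: "real (2 * k + 2) * (real (2 * k + 1) * ?h (2 * Suc k)) =
      (real (n + 2 * k + 1) * real (n + 2 * k)) * (a\<^sup>2 * ?h (2 * k))"
    by (simp add: power2_eq_square ac_simps del: chs.simps)
  have "real (2 * k + 1) * real n \<le> real (n + 2 * k + 1) * real (n + 2 * k)"
    by (intro mult_mono) auto
  then have "real (2 * k + 1) * real n * (a\<^sup>2 * ?h (2 * k)) \<le>
      real (2 * k + 2) * (real (2 * k + 1) * ?h (2 * Suc k))"
    unfolding rec using nn by (intro mult_right_mono) auto
  then have "real (2 * k + 1) * (real n * (a\<^sup>2 * ?h (2 * k))) \<le>
      real (2 * k + 1) * (real (2 * k + 2) * ?h (2 * Suc k))"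
    by (simp only: ac_simps)
  then have le: "real n * a\<^sup>2 * ?h (2 * k) \<le> real (2 * k + 2) * ?h (2 * Suc k)"
    by (subst (asm) mult_le_cancel_left_pos) (simp_all add: mult.assoc del: chs.simps)
  have "(real n * a\<^sup>2) ^ Suc k / (2 ^ Suc k * fact (Suc k)) =
      real n * a\<^sup>2 * ((real n * a\<^sup>2) ^ k / (2 ^ k * fact k)) / real (2 * k + 2)"
    by (simp add: field_simps)
  also have "\<dots> \<le> real n * a\<^sup>2 * ?h (2 * k) / real (2 * k + 2)"
    by (intro divide_right_mono mult_left_mono Suc.IH) auto
  also have "\<dots> \<le> ?h (2 * Suc k)"
    using le by (simp add: field_simps del: chs.simps)
  finally show ?case .
qed simp

text \<open>Hunter's inequality. The difference of the two sides does not decrease along the segment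
  from the constant list of the mean to \<open>xs\<close>: by the divided-difference identity its
  derivative is a combination, with nonnegative weights, of instances of the inequality for the
  previous \<open>k\<close>.\<close>

lemma hunter:
  "(\<Sum>x\<leftarrow>xs. x\<^sup>2) ^ k / (2 ^ k * fact k) \<le> chs xs (2 * k)"
proof (induction k arbitrary: xs)
  case (Suc k)
  note IH = Suc.IH
  define m where "m = sum_list xs / real (length xs)"
  define y where "y x t = m + t * (x - m)" for x t :: real
  define ys where "ys t = map (\<lambda>x. y x t) xs" for t
  define N where "N t = (\<Sum>x\<leftarrow>xs. (y x t)\<^sup>2)" for t
  define C :: "nat \<Rightarrow> real" where "C k = 1 / (2 ^ k * fact k)" for k
  define G where "G t = chs (ys t) (Suc (Suc (2 * k))) - C (Suc k) * N t ^ Suc k" for t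
  have N_nonneg: "0 \<le> N t" for t
    unfolding N_def by (intro sum_list_nonneg) auto
  have mean: "(\<Sum>x\<leftarrow>xs. x - m) = 0"
    by (cases "xs = []") (simp_all add: sum_list_subtractf m_def sum_list_triv)
  have N': "(N has_real_derivative (\<Sum>x\<leftarrow>xs. 2 * y x t * (x - m))) (at t)" for t
  proof -
    have "((\<lambda>t. \<Sum>x\<leftarrow>zs. (y x t)\<^sup>2) has_real_derivative (\<Sum>x\<leftarrow>zs. 2 * y x t * (x - m))) (at t)"
      for zs
      by (induction zs) (auto intro!: derivative_eq_intros simp: y_def)
    then show ?thesis unfolding N_def [abs_def] .
  qed
  define D where "D t = (\<Sum>x\<leftarrow>xs. (x - m) * (chs (y x t # ys t) (Suc (2 * k)) - C k * N t ^ k * y x t))" for t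
  have G': "(G has_real_derivative D t) (at t)" for t
  proof -
    have h: "((\<lambda>t. chs (ys t) (Suc (Suc (2 * k)))) has_real_derivative
        (\<Sum>x\<leftarrow>xs. (x - m) * chs (y x t # ys t) (Suc (2 * k)))) (at t)"
      unfolding ys_def
      by (rule has_real_derivative_chs) (auto intro!: derivative_eq_intros simp: y_def)
    have "(G has_real_derivative (\<Sum>x\<leftarrow>xs. (x - m) * chs (y x t # ys t) (Suc (2 * k))) -
        C (Suc k) * (real (Suc k) * ((\<Sum>x\<leftarrow>xs. 2 * y x t * (x - m)) * N t ^ k))) (at t)"
      unfolding G_def [abs_def]
      using DERIV_power[OF N'[of t], of "Suc k"]
      by (intro DERIV_diff h DERIV_cmult) (simp add: mult.assoc)
    also have "C (Suc k) * (real (Suc k) * ((\<Sum>x\<leftarrow>xs. 2 * y x t * (x - m)) * N t ^ k)) =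
        (C (Suc k) * real (Suc k) * 2) * N t ^ k * (\<Sum>x\<leftarrow>xs. y x t * (x - m))"
      by (simp add: sum_list_const_mult mult.assoc mult.left_commute)
    also have "C (Suc k) * real (Suc k) * 2 = C k"
      by (simp add: C_def field_simps del: of_nat_Suc)
    finally show ?thesis
      unfolding D_def
      by (simp add: right_diff_distrib sum_list_subtractf sum_list_const_mult[symmetric] ac_simps
          del: chs.simps)
  qed
  have D_nonneg: "0 \<le> D t" if "0 \<le> t" for t
  proof -
    \<comment> \<open>The deviations \<open>x - m\<close> sum to zero, so \<open>\<Phi> m\<close>
      can be subtracted inside every term. The divided difference identity then extracts
      \<open>y x t - m\<close>, which is \<open>t * (x - m)\<close>, and each term becomes a square
      times a nonnegative factor.\<close>
    define \<Phi> where "\<Phi> u = chs (u # ys t) (Suc (2 * k)) - C k * N t ^ k * u" for u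
    have "D t = (\<Sum>x\<leftarrow>xs. (x - m) * \<Phi> (y x t)) - \<Phi> m * (\<Sum>x\<leftarrow>xs. x - m)"
      unfolding mean by (simp add: D_def \<Phi>_def del: chs.simps)
    also have "\<dots> = (\<Sum>x\<leftarrow>xs. (x - m) * (\<Phi> (y x t) - \<Phi> m))"
      unfolding sum_list_const_mult[symmetric] sum_list_subtractf[symmetric]
      by (simp add: algebra_simps)
    also have "\<dots> \<ge> 0"
    proof (rule sum_list_nonneg, clarsimp)
      fix x
      \<comment> \<open>The induction hypothesis is used for a list with two more entries, which is
        why \<open>xs\<close> is generalized. Their squares only enlarge the sum
        \<open>N t\<close>.\<close>
      have "C k * N t ^ k \<le> C k * (\<Sum>x\<leftarrow>y x t # m # ys t. x\<^sup>2) ^ k"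
        unfolding C_def
        by (intro mult_left_mono power_mono N_nonneg) (auto simp: N_def ys_def o_def)
      also have "\<dots> \<le> chs (y x t # m # ys t) (2 * k)"
        using IH[of "y x t # m # ys t"] by (simp add: C_def)
      finally have "0 \<le> t * (x - m)\<^sup>2 * (chs (y x t # m # ys t) (2 * k) - C k * N t ^ k)"
        using that by simp
      also have "t * (x - m)\<^sup>2 = (x - m) * (y x t - m)"
        by (simp add: y_def power2_eq_square)
      also have "(x - m) * (y x t - m) * (chs (y x t # m # ys t) (2 * k) - C k * N t ^ k) =
         (x - m) * (\<Phi> (y x t) - \<Phi> m)"
        unfolding mult.assoc right_diff_distrib[of "y x t - m"] chs_divided_difference \<Phi>_def
        by (simp add: algebra_simps del: chs.simps)
      finally show "0 \<le> (x - m) * (\<Phi> (y x t) - \<Phi> m)" .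
    qed
    finally show ?thesis .
  qed
  have "G 0 \<le> G 1"
    by (rule DERIV_nonneg_imp_nondecreasing) (use G' D_nonneg in auto)
  \<comment> \<open>At \<open>t = 0\<close> every entry is the mean \<open>m\<close>, so the case of
    equal entries applies.\<close>
  moreover have "0 \<le> G 0"
    using hunter_replicate[of "length xs" m "Suc k"]
    by (simp add: G_def ys_def N_def y_def C_def map_replicate_const sum_list_replicate
        del: chs.simps)
  moreover have "G 1 = chs xs (2 * Suc k) - C (Suc k) * (\<Sum>x\<leftarrow>xs. x\<^sup>2) ^ Suc k"
    by (simp add: G_def ys_def N_def y_def del: chs.simps)
  ultimately show ?case by (simp add: C_def del: chs.simps)
qed simp

text \<open>Applied to squares, this bounds the power sum of order \<open>2 * k\<close> by the
  \<open>k\<close>-th power of the sum of squares, the quantity in Hunter's inequality.\<close>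

lemma sum_power_le_power_sum:
  fixes y :: "'i \<Rightarrow> real"
  assumes "finite I" "\<And>i. i \<in> I \<Longrightarrow> 0 \<le> y i" "0 < k"
  shows "(\<Sum>i\<in>I. y i ^ k) \<le> (\<Sum>i\<in>I. y i) ^ k"
proof -
  obtain j where k: "k = Suc j" using assms(3) gr0_implies_Suc by blast
  have "(\<Sum>i\<in>I. y i * y i ^ j) \<le> (\<Sum>i\<in>I. y i * (\<Sum>i\<in>I. y i) ^ j)"
    using assms by (intro sum_mono mult_left_mono power_mono member_le_sum) auto
  then show ?thesis by (simp add: k sum_distrib_right)
qed

section \<open>Moments of independent exponential variables\<close>

text \<open>Split off one variable and expand by the binomial theorem. The moments
  \<open>fact j * a i ^ j\<close> cancel the factorials in the binomial coefficient, leaving the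
  convolution that defines \<open>chs\<close> up to the factor \<open>fact m\<close>.\<close>

lemma (in prob_space) moments_sum_exponential:
  fixes X :: "'i \<Rightarrow> 'a \<Rightarrow> real"
  assumes "distinct xs"
    and "indep_vars (\<lambda>_. borel) X (set xs)"
    and "\<And>i. i \<in> set xs \<Longrightarrow> distributed M lborel (X i) (exponential_density 1)"
  shows "has_bochner_integral M (\<lambda>\<omega>. (\<Sum>i\<in>set xs. a i * X i \<omega>) ^ m) (fact m * chs (map a xs) m)"
  using assms
proof (induction xs arbitrary: m)
  case Nil
  show ?case
    by (cases m) (auto simp: has_bochner_integral_iff prob_space)
next
  case (Cons i xs)
  let ?S = "\<lambda>\<omega>. \<Sum>i\<in>set xs. a i * X i \<omega>"
  have S: "has_bochner_integral M (\<lambda>\<omega>. ?S \<omega> ^ m) (fact m * chs (map a xs) m)" for m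
    using Cons.prems by (intro Cons.IH) (auto intro: indep_vars_subset)
  have Y: "has_bochner_integral M (\<lambda>\<omega>. (a i * X i \<omega>) ^ j) (fact j * a i ^ j)" for j
    using has_bochner_integral_erlang_ith_moment[of 1 "X i" 0 j] Cons.prems(3)[of i]
      has_bochner_integral_mult_right[of "a i ^ j" M "\<lambda>\<omega>. X i \<omega> ^ j" "fact j"]
    by (simp add: power_mult_distrib mult.commute)
  have "indep_vars (\<lambda>_. borel) (\<lambda>j \<omega>. a j * X j \<omega>) (insert i (set xs))"
    by (rule indep_vars_compose2[where Y="\<lambda>j x. a j * x" and M'="\<lambda>_. borel"])
      (use Cons.prems in auto)
  then have ind: "indep_var borel (\<lambda>\<omega>. a i * X i \<omega>) borel ?S"
    using Cons.prems by (intro indep_vars_sum) auto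
  have ind': "indep_var borel (\<lambda>\<omega>. (a i * X i \<omega>) ^ j) borel (\<lambda>\<omega>. ?S \<omega> ^ l)" for j l
    using indep_var_compose[OF ind, of "\<lambda>x. x ^ j" borel "\<lambda>x. x ^ l" borel] by (simp add: o_def)
  have YS: "has_bochner_integral M (\<lambda>\<omega>. (a i * X i \<omega>) ^ j * ?S \<omega> ^ l)
      ((fact j * a i ^ j) * (fact l * chs (map a xs) l))" for j l
    using Y[of j] S[of l] indep_var_integrable[OF ind'[of j l]]
      indep_var_lebesgue_integral[OF ind'[of j l]]
    by (simp add: has_bochner_integral_iff)
  have "has_bochner_integral M
      (\<lambda>\<omega>. \<Sum>j\<le>m. real (m choose j) * ((a i * X i \<omega>) ^ j * ?S \<omega> ^ (m - j)))
      (\<Sum>j\<le>m. real (m choose j) * ((fact j * a i ^ j) * (fact (m - j) * chs (map a xs) (m - j))))"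
    by (intro has_bochner_integral_sum has_bochner_integral_mult_right YS)
  also have "(\<lambda>\<omega>. \<Sum>j\<le>m. real (m choose j) * ((a i * X i \<omega>) ^ j * ?S \<omega> ^ (m - j))) =
      (\<lambda>\<omega>. (\<Sum>i\<in>set (i # xs). a i * X i \<omega>) ^ m)"
    using Cons.prems(1) by (simp add: binomial_ring mult.assoc)
  also have "(\<Sum>j\<le>m. real (m choose j) * ((fact j * a i ^ j) * (fact (m - j) * chs (map a xs) (m - j)))) =
      (\<Sum>j\<le>m. fact m * (a i ^ j * chs (map a xs) (m - j)))"
  proof (rule sum.cong)
    fix j assume "j \<in> {..m}"
    then have fact_m: "real (m choose j) * fact j * fact (m - j) = fact m"
      by (simp add: binomial_fact)
    show "real (m choose j) * ((fact j * a i ^ j) * (fact (m - j) * chs (map a xs) (m - j))) =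
        fact m * (a i ^ j * chs (map a xs) (m - j))"
      unfolding fact_m[symmetric] by (simp only: ac_simps)
  qed simp
  also have "\<dots> = fact m * chs (map a (i # xs)) m"
    by (simp add: chs_Cons_conv_sum sum_distrib_left)
  finally show ?case .
qed

text \<open>The law of a vector whose coordinates are independent standard exponential variables.
  Giving it by a density against \<open>lborel\<close> keeps it open to a linear change of
  variables.\<close>

definition exponential_lborel :: "'a::euclidean_space measure" where
  "exponential_lborel = density lborel (\<lambda>p. \<Prod>b\<in>Basis. ennreal (exponential_density 1 (p \<bullet> b)))"

lemma sets_exponential_lborel [simp, measurable_cong]: "sets exponential_lborel = sets borel"
  by (simp add: exponential_lborel_def)

lemma space_exponential_lborel [simp]: "space exponential_lborel = UNIV"
  by (simp add: exponential_lborel_def)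

lemma emeasure_exponential_lborel:
  assumes [measurable]: "\<And>b. b \<in> Basis \<Longrightarrow> A b \<in> sets borel"
  shows "emeasure exponential_lborel {p :: 'a::euclidean_space. \<forall>b\<in>Basis. p \<bullet> b \<in> A b} =
    (\<Prod>b\<in>Basis. emeasure (density lborel (exponential_density 1)) (A b))"
proof -
  have [measurable]: "{p :: 'a. \<forall>b\<in>Basis. p \<bullet> b \<in> A b} \<in> sets borel"
  proof -
    have "{p \<in> space borel. \<forall>b\<in>Basis. (p :: 'a) \<bullet> b \<in> A b} \<in> sets borel"
      by (intro sets.sets_Collect_finite_All') measurable
    then show ?thesis by simp
  qed
  have "emeasure exponential_lborel {p :: 'a. \<forall>b\<in>Basis. p \<bullet> b \<in> A b} =
      (\<integral>\<^sup>+p. (\<Prod>b\<in>Basis. ennreal (exponential_density 1 (p \<bullet> b)) * indicator (A b) (p \<bullet> b)) \<partial>lborel)"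
    unfolding exponential_lborel_def
    by (subst emeasure_density) (auto simp: prod.distrib indicator_def prod_zero_iff intro!: nn_integral_cong)
  also have "\<dots> = (\<Prod>b\<in>Basis. \<integral>\<^sup>+x. ennreal (exponential_density 1 x) * indicator (A b) x \<partial>lborel)"
    by (rule nn_integral_lborel_prod) auto
  also have "\<dots> = (\<Prod>b\<in>Basis. emeasure (density lborel (exponential_density 1)) (A b))"
    by (intro prod.cong) (auto simp: emeasure_density)
  finally show ?thesis .
qed

lemma emeasure_exponential_density_UNIV:
  "emeasure (density lborel (exponential_density 1)) UNIV = 1"
  using prob_space.emeasure_space_1[OF prob_space_exponential_density[of 1]] by simp

lemma prob_space_exponential_lborel: "prob_space (exponential_lborel :: 'a::euclidean_space measure)"
  using emeasure_exponential_lborel[of "\<lambda>_::'a. UNIV"]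
  by (intro prob_spaceI) (simp add: emeasure_exponential_density_UNIV)

text \<open>Coordinates outside \<open>J\<close> are left free and contribute total mass 1.
  Singletons \<open>J\<close> give the marginal laws, and comparing these with general
  \<open>J\<close> gives independence.\<close>

lemma emeasure_exponential_lborel_subset:
  assumes J: "J \<subseteq> Basis" and A: "\<And>b. b \<in> J \<Longrightarrow> A b \<in> sets borel"
  shows "emeasure exponential_lborel {p :: 'a::euclidean_space. \<forall>b\<in>J. p \<bullet> b \<in> A b} =
    (\<Prod>b\<in>J. emeasure (density lborel (exponential_density 1)) (A b))"
proof -
  let ?A = "\<lambda>b. if b \<in> J then A b else UNIV"
  have "{p :: 'a. \<forall>b\<in>J. p \<bullet> b \<in> A b} = {p. \<forall>b\<in>Basis. p \<bullet> b \<in> ?A b}"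
    using J by auto
  also have "emeasure exponential_lborel \<dots> =
      (\<Prod>b\<in>Basis. emeasure (density lborel (exponential_density 1)) (?A b))"
    using A by (intro emeasure_exponential_lborel) auto
  also have "\<dots> = (\<Prod>b\<in>J. emeasure (density lborel (exponential_density 1)) (A b))"
    using J by (intro prod.mono_neutral_cong_right)
      (auto simp: emeasure_exponential_density_UNIV)
  finally show ?thesis .
qed

lemma distributed_exponential_lborel:
  assumes "b \<in> Basis"
  shows "distributed (exponential_lborel :: 'a::euclidean_space measure) lborel (\<lambda>p. p \<bullet> b)
    (exponential_density 1)"
  unfolding distributed_def
proof (intro conjI measure_eqI)
  fix A :: "real set" assume "A \<in> sets (distr exponential_lborel lborel (\<lambda>p::'a. p \<bullet> b))"
  then have [measurable]: "A \<in> sets borel" by simp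
  show "emeasure (distr exponential_lborel lborel (\<lambda>p::'a. p \<bullet> b)) A =
      emeasure (density lborel (\<lambda>x. ennreal (exponential_density 1 x))) A"
    using emeasure_exponential_lborel_subset[of "{b}" "\<lambda>_. A"] assms
    by (subst emeasure_distr) (auto simp: vimage_def)
qed auto

lemma indep_vars_exponential_lborel:
  "prob_space.indep_vars (exponential_lborel :: 'a::euclidean_space measure) (\<lambda>_. borel)
     (\<lambda>b p. p \<bullet> b) Basis"
proof -
  interpret prob_space "exponential_lborel :: 'a measure" by (rule prob_space_exponential_lborel)
  show ?thesis
    unfolding indep_vars_def2
  proof (intro conjI indep_setsI ballI)
    fix J :: "'a set" and F
    assume J: "J \<noteq> {}" "J \<subseteq> Basis" "finite J"
      and "\<forall>j\<in>J. F j \<in> {(\<lambda>p. p \<bullet> j) -` A \<inter> space exponential_lborel |A. A \<in> sets borel}"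
    then obtain A where A: "\<And>j. j \<in> J \<Longrightarrow> F j = (\<lambda>p. p \<bullet> j) -` A j" "\<And>j. j \<in> J \<Longrightarrow> A j \<in> sets borel"
      by (simp add: bchoice_iff) metis
    have F: "emeasure exponential_lborel (F j) = emeasure (density lborel (exponential_density 1)) (A j)"
      if "j \<in> J" for j
      using emeasure_exponential_lborel_subset[of "{j}" A] that J A by (auto simp: vimage_def)
    have "(\<Inter>j\<in>J. F j) = {p. \<forall>b\<in>J. p \<bullet> b \<in> A b}"
      using A by auto
    then have "emeasure exponential_lborel (\<Inter>j\<in>J. F j) = (\<Prod>j\<in>J. emeasure exponential_lborel (F j))"
      using J A(2) by (simp add: emeasure_exponential_lborel_subset F cong: prod.cong)
    then show "prob (\<Inter>j\<in>J. F j) = (\<Prod>j\<in>J. prob (F j))"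
      by (simp add: emeasure_eq_measure prod_ennreal prod_nonneg)
  qed (auto intro!: measurable_sets_borel[where M=borel])
qed

text \<open>The moment is restated as a nonnegative integral, the form in which the change of
  variables is available. Since \<open>ennreal\<close> cuts off negative values, the integrand must
  be nonnegative on the orthant that carries the measure.\<close>

lemma nn_integral_exponential_lborel_power:
  fixes a :: "'a::euclidean_space \<Rightarrow> real"
  assumes "distinct xs" "set xs = Basis"
    and nonneg: "\<And>p. (\<And>b. b \<in> Basis \<Longrightarrow> 0 \<le> p \<bullet> b) \<Longrightarrow> 0 \<le> (\<Sum>b\<in>Basis. a b * (p \<bullet> b)) ^ m"
  shows "(\<integral>\<^sup>+p. ennreal ((\<Sum>b\<in>Basis. a b * (p \<bullet> b)) ^ m) \<partial>exponential_lborel) =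
    ennreal (fact m * chs (map a xs) m)"
proof -
  interpret prob_space "exponential_lborel :: 'a measure" by (rule prob_space_exponential_lborel)
  have I: "has_bochner_integral exponential_lborel
      (\<lambda>p. (\<Sum>b\<in>Basis. a b * (p \<bullet> b)) ^ m) (fact m * chs (map a xs) m)"
    using moments_sum_exponential[OF assms(1), of "\<lambda>b p. p \<bullet> b" a m]
      indep_vars_exponential_lborel distributed_exponential_lborel
    unfolding assms(2) by blast
  have "AE p in exponential_lborel. 0 \<le> (\<Sum>b\<in>Basis. a b * ((p :: 'a) \<bullet> b)) ^ m"
    unfolding exponential_lborel_def
  proof (subst AE_density, simp, intro AE_I2 impI nonneg)
    fix p b :: 'a
    assume "0 < (\<Prod>b\<in>Basis. ennreal (exponential_density 1 (p \<bullet> b)))" and b: "b \<in> Basis"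
    then have "ennreal (exponential_density 1 (p \<bullet> b)) \<noteq> 0"
      using prod_zero[OF finite_Basis, of "\<lambda>b. ennreal (exponential_density 1 (p \<bullet> b))"] by fastforce
    then show "0 \<le> p \<bullet> b"
      by (auto simp: exponential_density_def split: if_splits)
  qed
  with I show ?thesis
    by (subst nn_integral_eq_integral) (auto simp: has_bochner_integral_iff)
qed

section \<open>Lebesgue measure under linear bijections\<close>

lemma nn_integral_lborel_affine:
  fixes f :: "'a::euclidean_space \<Rightarrow> ennreal"
  assumes [measurable]: "f \<in> borel_measurable borel" and "c \<noteq> 0"
  shows "(\<integral>\<^sup>+x. f x \<partial>lborel) = ennreal (\<bar>c\<bar> ^ DIM('a)) * (\<integral>\<^sup>+x. f (t + c *\<^sub>R x) \<partial>lborel)"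
  by (subst lborel_affine[OF \<open>c \<noteq> 0\<close>, of t])
    (simp add: nn_integral_density nn_integral_distr nn_integral_cmult ennreal_power)

lemma nn_integral_lborel_translate:
  fixes f :: "'a::euclidean_space \<Rightarrow> ennreal"
  assumes "f \<in> borel_measurable borel"
  shows "(\<integral>\<^sup>+x. f (t + x) \<partial>lborel) = (\<integral>\<^sup>+x. f x \<partial>lborel)"
  using nn_integral_lborel_affine[OF assms, of 1 t] by simp

lemma nn_integral_lborel_reflect:
  fixes f :: "'a::euclidean_space \<Rightarrow> ennreal"
  assumes "f \<in> borel_measurable borel"
  shows "(\<integral>\<^sup>+x. f (t - x) \<partial>lborel) = (\<integral>\<^sup>+x. f x \<partial>lborel)"
  using nn_integral_lborel_affine[OF assms, of "-1" t] by simp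

text \<open>Uniqueness of Haar measure: evaluating the double integral of
  \<open>g (T p) * u (T p + y)\<close> in both orders gives the symmetry of the product below.\<close>

lemma nn_integral_lborel_linear_commute:
  fixes T :: "'a::euclidean_space \<Rightarrow> 'b::euclidean_space"
  assumes T: "linear T" "surj T"
    and [measurable]: "g \<in> borel_measurable borel" "u \<in> borel_measurable borel"
  shows "(\<integral>\<^sup>+p. g (T p) \<partial>lborel) * (\<integral>\<^sup>+y. u y \<partial>lborel) =
    (\<integral>\<^sup>+p. u (T p) \<partial>lborel) * (\<integral>\<^sup>+y. g y \<partial>lborel)"
proof -
  have [measurable]: "T \<in> borel_measurable borel"
    using T by (intro borel_measurable_continuous_onI linear_continuous_on) (simp add: linear_conv_bounded_linear)
  have "(\<integral>\<^sup>+p. g (T p) \<partial>lborel) * (\<integral>\<^sup>+y. u y \<partial>lborel) =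
      (\<integral>\<^sup>+p. g (T p) * (\<integral>\<^sup>+y. u (T p + y) \<partial>lborel) \<partial>lborel)"
    by (simp add: nn_integral_lborel_translate nn_integral_multc)
  also have "\<dots> = (\<integral>\<^sup>+p. (\<integral>\<^sup>+y. g (T p) * u (T p + y) \<partial>lborel) \<partial>lborel)"
    by (simp add: nn_integral_cmult)
  also have "\<dots> = (\<integral>\<^sup>+y. (\<integral>\<^sup>+p. g (T p) * u (T p + y) \<partial>lborel) \<partial>lborel)"
    by (rule lborel_pair.Fubini'[symmetric]) measurable
  \<comment> \<open>For fixed \<open>y\<close>, surjectivity gives \<open>w\<close> with
    \<open>T w = y\<close>, and translating \<open>p\<close> by \<open>w\<close> moves the shift
    from \<open>u\<close> to \<open>g\<close>.\<close>
  also have "\<dots> = (\<integral>\<^sup>+y. (\<integral>\<^sup>+p. g (T p - y) * u (T p) \<partial>lborel) \<partial>lborel)"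
  proof (rule nn_integral_cong)
    fix y
    obtain w where w: "y = T w" using T(2) by auto
    have "(\<integral>\<^sup>+p. g (T p - y) * u (T p) \<partial>lborel) =
        (\<integral>\<^sup>+p. g (T (w + p) - y) * u (T (w + p)) \<partial>lborel)"
      by (rule nn_integral_lborel_translate[symmetric]) measurable
    then show "(\<integral>\<^sup>+p. g (T p) * u (T p + y) \<partial>lborel) = (\<integral>\<^sup>+p. g (T p - y) * u (T p) \<partial>lborel)"
      by (simp add: w linear_add[OF T(1)] add.commute)
  qed
  also have "\<dots> = (\<integral>\<^sup>+p. (\<integral>\<^sup>+y. g (T p - y) * u (T p) \<partial>lborel) \<partial>lborel)"
    by (rule lborel_pair.Fubini') measurable
  also have "\<dots> = (\<integral>\<^sup>+p. u (T p) * (\<integral>\<^sup>+y. g y \<partial>lborel) \<partial>lborel)"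
    by (intro nn_integral_cong)
      (simp add: nn_integral_multc nn_integral_lborel_reflect mult.commute[of "u _"])
  also have "\<dots> = (\<integral>\<^sup>+p. u (T p) \<partial>lborel) * (\<integral>\<^sup>+y. g y \<partial>lborel)"
    by (simp add: nn_integral_multc)
  finally show ?thesis .
qed

text \<open>In the symmetric identity take for \<open>u\<close> the indicator of the unit box, which
  has integral 1. Then \<open>\<kappa>\<close> is the measure of the preimage of the box, positive
  because the preimage is open and nonempty, finite because it is bounded.\<close>

lemma nn_integral_lborel_linear:
  fixes T :: "'a::euclidean_space \<Rightarrow> 'b::euclidean_space"
  assumes T: "linear T" "bij T"
  obtains \<kappa> :: real where "0 < \<kappa>"
    "\<And>g. g \<in> borel_measurable borel \<Longrightarrow>
      (\<integral>\<^sup>+p. g (T p) \<partial>lborel) = ennreal \<kappa> * (\<integral>\<^sup>+y. g y \<partial>lborel)"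
proof -
  let ?B = "box 0 One :: 'b set"
  let ?\<kappa> = "emeasure lborel (T -` ?B)"
  have T_cont: "continuous_on UNIV T"
    using T(1) by (simp add: linear_continuous_on linear_conv_bounded_linear)
  obtain S where "linear S" "S \<circ> T = id"
    using linear_injective_left_inverse[OF T(1)] T(2) bij_is_inj by blast
  then have S: "linear S" "\<And>x. S (T x) = x"
    by (simp_all add: fun_eq_iff)
  have TS: "T (S y) = y" for y
    using S(2) bij_is_surj[OF T(2)] by (metis surjD)
  have op: "open (T -` ?B)"
    using T_cont by (intro open_vimage) auto
  have "One /\<^sub>R 2 \<in> ?B"
    by (auto simp: box_def)
  then have "S (One /\<^sub>R 2) \<in> T -` ?B" by (simp add: TS)
  then have ne: "T -` ?B \<noteq> {}" by blast
  have "T -` ?B \<subseteq> S ` cbox 0 One"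
  proof
    fix x assume "x \<in> T -` ?B"
    then have "T x \<in> cbox 0 One" using box_subset_cbox by blast
    then show "x \<in> S ` cbox 0 One" using S(2)[of x] by (metis imageI)
  qed
  moreover have "compact (S ` cbox 0 One)"
    using S(1) by (intro compact_continuous_image) (auto simp: linear_continuous_on linear_conv_bounded_linear)
  ultimately have "bounded (T -` ?B)"
    using bounded_subset compact_imp_bounded by blast
  then have fin: "?\<kappa> < \<infinity>" by (rule emeasure_bounded_finite)
  have pos: "0 < ?\<kappa>"
  proof (rule ccontr)
    assume "\<not> 0 < ?\<kappa>"
    then have "T -` ?B \<in> null_sets lborel"
      using op by (auto simp: null_sets_def)
    then have "negligible (T -` ?B)"
      unfolding negligible_iff_null_sets by (rule null_sets_completionI)
    then show False using op ne open_not_negligible by blast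
  qed
  show ?thesis
  proof (rule that[of "enn2real ?\<kappa>"])
    show "0 < enn2real ?\<kappa>" using pos fin by (simp add: enn2real_positive_iff)
    fix g :: "'b \<Rightarrow> ennreal" assume g: "g \<in> borel_measurable borel"
    have "(\<integral>\<^sup>+p. indicator ?B (T p) \<partial>lborel) = (\<integral>\<^sup>+p. indicator (T -` ?B) p \<partial>lborel)"
      by (rule nn_integral_cong) (simp add: indicator_def)
    also have "\<dots> = ?\<kappa>" using op by (simp)
    finally show "(\<integral>\<^sup>+p. g (T p) \<partial>lborel) = ennreal (enn2real ?\<kappa>) * (\<integral>\<^sup>+y. g y \<partial>lborel)"
      using nn_integral_lborel_linear_commute[OF T(1) bij_is_surj[OF T(2)] g, of "indicator ?B"] fin
      by simp
  qed
qed

section \<open>The cone over a simplex\<close>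

text \<open>The vertices are indexed by the standard basis of a space one dimension higher, so that
  barycentric weights become Cartesian coordinates there.\<close>

locale simplex_vertices =
  fixes V :: "(real^'n) set" and \<beta> :: "(real^'n) \<times> real \<Rightarrow> real^'n"
  assumes affine_indep: "\<not> affine_dependent V"
    and bij_vertices: "bij_betw \<beta> Basis V"
begin

text \<open>\<open>cone_map\<close> takes the nonnegative orthant onto the cone over \<open>convex hull V\<close>, and the coordinate
  sum to the height; this is what turns integrals over the cone weighted by \<open>exp (- z)\<close> into
  moments of independent exponential variables.\<close>

definition cone_map :: "(real^'n) \<times> real \<Rightarrow> (real^'n) \<times> real" where
  "cone_map p = (\<Sum>b\<in>Basis. (p \<bullet> b) *\<^sub>R (\<beta> b, 1))"

definition simplex_cone :: "((real^'n) \<times> real) set" where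
  "simplex_cone = {(x, z). 0 \<le> z \<and> x \<in> scale_set z (convex hull V)}"

lemma finite_vertices: "finite V"
  using bij_betw_finite[OF bij_vertices] by simp

lemma sum_vertices: "(\<Sum>v\<in>V. F v) = (\<Sum>b\<in>Basis. F (\<beta> b))"
  by (rule sum.reindex_bij_betw[OF bij_vertices, symmetric])

lemma vertices_nonempty: "V \<noteq> {}"
  using bij_betw_imp_surj_on[OF bij_vertices] nonempty_Basis by blast

lemma cone_map_eq: "cone_map p = (\<Sum>b\<in>Basis. (p \<bullet> b) *\<^sub>R \<beta> b, \<Sum>b\<in>Basis. p \<bullet> b)"
  by (simp add: cone_map_def prod_eq_iff fst_sum snd_sum)

lemma linear_cone_map: "linear cone_map"
  by (rule linearI)
    (simp_all add: cone_map_def inner_add_left scaleR_left_distrib sum.distrib scaleR_sum_right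
      del: scaleR_Pair)

text \<open>The coordinates of a kernel vector sum to zero and annihilate the vertices, hence form
  an affine dependence.\<close>

lemma inj_cone_map: "inj cone_map"
proof (rule linear_injective_0[OF linear_cone_map, THEN iffD2], intro allI impI)
  fix p assume "cone_map p = 0"
  then have 0: "(\<Sum>b\<in>Basis. (p \<bullet> b) *\<^sub>R \<beta> b) = 0" "(\<Sum>b\<in>Basis. p \<bullet> b) = 0"
    by (simp_all add: cone_map_eq zero_prod_def)
  define U where "U v = p \<bullet> the_inv_into Basis \<beta> v" for v
  have U: "U (\<beta> b) = p \<bullet> b" if "b \<in> Basis" for b
    using the_inv_into_f_f[OF bij_betw_imp_inj_on[OF bij_vertices] that] by (simp add: U_def)
  have "sum U V = 0" "(\<Sum>v\<in>V. U v *\<^sub>R v) = 0"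
    using 0 by (simp_all add: sum_vertices U)
  then have U0: "\<forall>v\<in>V. U v = 0"
    using affine_indep affine_dependent_explicit_finite[OF finite_vertices] by blast
  have "p \<bullet> b = 0" if "b \<in> Basis" for b
    using U[OF that] U0 bij_betw_apply[OF bij_vertices that] by simp
  then show "p = 0" using euclidean_all_zero_iff[of p] by blast
qed

lemma bij_cone_map: "bij cone_map"
  using linear_injective_imp_surjective[OF linear_cone_map inj_cone_map] inj_cone_map
  by (simp add: bij_def)

text \<open>The coordinates of a preimage are the height times the barycentric weights; injectivity
  makes them the coordinates of \<open>p\<close>. Conversely, dividing by the height gives weights,
  and height zero leaves only the apex.\<close>

lemma cone_map_in_simplex_cone_iff:
  "cone_map p \<in> simplex_cone \<longleftrightarrow> (\<forall>b\<in>Basis. 0 \<le> p \<bullet> b)"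
proof
  assume "cone_map p \<in> simplex_cone"
  then obtain z u where zu: "0 \<le> z" "u \<in> convex hull V" "cone_map p = (z *\<^sub>R u, z)"
    by (auto simp: simplex_cone_def scale_set_def cone_map_eq)
  then obtain w where w: "\<forall>v\<in>V. 0 \<le> w v" "sum w V = 1" "(\<Sum>v\<in>V. w v *\<^sub>R v) = u"
    using convex_hull_finite[OF finite_vertices] by auto
  define p' where "p' = (\<Sum>b\<in>Basis. (z * w (\<beta> b)) *\<^sub>R b)"
  have p': "p' \<bullet> b = z * w (\<beta> b)" if "b \<in> Basis" for b
    using that by (simp add: p'_def)
  have "cone_map p' = (z *\<^sub>R (\<Sum>b\<in>Basis. w (\<beta> b) *\<^sub>R \<beta> b), z * (\<Sum>b\<in>Basis. w (\<beta> b)))"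
    by (simp add: cone_map_eq p' scaleR_sum_right sum_distrib_left)
  also have "\<dots> = (z *\<^sub>R u, z)"
    using w(2,3) by (simp add: sum_vertices)
  finally have "cone_map p' = (z *\<^sub>R u, z)" .
  then have "p = p'" using zu(3) inj_eq[OF inj_cone_map, of p p'] by simp
  then show "\<forall>b\<in>Basis. 0 \<le> p \<bullet> b"
    using zu(1) w(1) bij_betw_apply[OF bij_vertices] by (auto simp: p')
next
  assume p: "\<forall>b\<in>Basis. 0 \<le> p \<bullet> b"
  let ?z = "\<Sum>b\<in>Basis. p \<bullet> b"
  have z: "0 \<le> ?z" using p by (simp add: sum_nonneg)
  have "(\<Sum>b\<in>Basis. (p \<bullet> b) *\<^sub>R \<beta> b) \<in> scale_set ?z (convex hull V)"
  proof (cases "?z = 0")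
    case True
    then have "\<forall>b\<in>Basis. p \<bullet> b = 0"
      using p by (simp add: sum_nonneg_eq_0_iff)
    then have eq: "(\<Sum>b\<in>Basis. (p \<bullet> b) *\<^sub>R \<beta> b) = 0" by simp
    obtain v where "v \<in> V" using vertices_nonempty by blast
    then have "v \<in> convex hull V" by (rule hull_inc)
    then show ?thesis
      unfolding eq True scale_set_def by (intro image_eqI[of _ _ v]) simp_all
  next
    case False
    have "(\<Sum>b\<in>Basis. ((p \<bullet> b) / ?z) *\<^sub>R \<beta> b) \<in> convex hull V"
      using p z False bij_betw_apply[OF bij_vertices]
      by (intro convex_sum) (auto simp: convex_convex_hull hull_inc sum_divide_distrib[symmetric])
    then show ?thesis
      unfolding scale_set_def
      by (rule image_eqI[rotated]) (use False in \<open>simp add: scaleR_sum_right\<close>)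
  qed
  then show "cone_map p \<in> simplex_cone"
    using z by (simp add: simplex_cone_def cone_map_eq)
qed

lemma in_simplex_cone_scaleR_iff:
  assumes "0 < z"
  shows "(z *\<^sub>R u, z) \<in> simplex_cone \<longleftrightarrow> u \<in> convex hull V"
proof -
  have "inj (\<lambda>u::real^'n. z *\<^sub>R u)"
    using assms by (simp add: inj_def)
  then show ?thesis
    using assms inj_image_mem_iff[of "\<lambda>u. z *\<^sub>R u" u "convex hull V"]
    unfolding simplex_cone_def scale_set_def by simp
qed

section \<open>Inverse coordinates, closedness of the cone and the homogenized interpolant\<close>

lemma cone_map_inverse:
  obtains S where "linear S" "\<And>p. S (cone_map p) = p" "\<And>y. cone_map (S y) = y"
proof -
  obtain S where S: "linear S" "S \<circ> cone_map = id"
    using linear_injective_left_inverse[OF linear_cone_map inj_cone_map] by blast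
  have inv: "S (cone_map p) = p" for p
    using fun_cong[OF S(2), of p] by simp
  moreover have "cone_map (S y) = y" for y
  proof -
    obtain p where "y = cone_map p" using bij_is_surj[OF bij_cone_map] by blast
    then show ?thesis by (simp add: inv)
  qed
  ultimately show ?thesis using S(1) that by blast
qed

lemma closed_simplex_cone: "closed simplex_cone"
proof -
  obtain S where S: "linear S" "\<And>y. cone_map (S y) = y"
    by (rule cone_map_inverse) blast
  have "simplex_cone = (\<Inter>b\<in>Basis. {y. 0 \<le> S y \<bullet> b})"
    using cone_map_in_simplex_cone_iff[of "S _"] S(2) by auto
  moreover have "closed {y. 0 \<le> S y \<bullet> b}" for b
    using S(1) by (intro closed_Collect_le continuous_intros)
      (simp add: linear_continuous_on linear_conv_bounded_linear)
  ultimately show ?thesis by auto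
qed

text \<open>The vectors \<open>(v, 1)\<close> are the images of the basis under
  \<open>cone_map\<close>, so exactly one linear functional takes the values \<open>f v\<close> on
  them. This settles the definite description in \<open>affine_interp_coef\<close>; the functional
  is pulled back by the adjoint of the inverse.\<close>

lemma persp_mu_eq_inner:
  obtains w where "\<And>x z. persp_mu f V x z = w \<bullet> (x, z)"
    "\<And>p. w \<bullet> cone_map p = (\<Sum>b\<in>Basis. f (\<beta> b) * (p \<bullet> b))"
proof -
  obtain S where S: "linear S" "\<And>p. S (cone_map p) = p"
    by (rule cone_map_inverse) blast
  define w where "w = adjoint S (\<Sum>b\<in>Basis. f (\<beta> b) *\<^sub>R b)"
  have w: "w \<bullet> cone_map p = (\<Sum>b\<in>Basis. f (\<beta> b) * (p \<bullet> b))" for p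
    using adjoint_works[OF S(1), of "cone_map p" "\<Sum>b\<in>Basis. f (\<beta> b) *\<^sub>R b"]
    by (simp add: w_def S(2) inner_commute inner_sum_right)
  have cb: "cone_map b = (\<beta> b, 1)" if "b \<in> Basis" for b
    using that
    by (simp add: cone_map_eq inner_Basis if_distrib[of "\<lambda>c. c *\<^sub>R _"] sum.delta cong: if_cong)
  have wV: "w \<bullet> (v, 1) = f v" if v: "v \<in> V" for v
  proof -
    obtain b where b: "b \<in> Basis" "v = \<beta> b"
      using v bij_betw_imp_surj_on[OF bij_vertices] by blast
    then show ?thesis
      using w[of b] cb[of b] by (simp add: inner_Basis if_distrib sum.delta cong: if_cong)
  qed
  have "affine_interp_coef f V = w"
    unfolding affine_interp_coef_def
  proof (rule the_equality)
    show "\<forall>v\<in>V. fst w \<bullet> v + snd w = f v"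
      using wV by (auto simp: inner_prod_def)
    fix ab assume ab: "\<forall>v\<in>V. fst ab \<bullet> v + snd ab = f v"
    have "ab \<bullet> cone_map p = w \<bullet> cone_map p" for p
      unfolding cone_map_def inner_sum_right inner_scaleR_right
      by (intro sum.cong arg_cong2[where f="(*)"] refl)
         (use ab wV bij_betw_apply[OF bij_vertices] in \<open>auto simp: inner_prod_def\<close>)
    then have "ab \<bullet> y = w \<bullet> y" for y
      using surjD[OF bij_is_surj[OF bij_cone_map], of y] by auto
    then show "ab = w" using vector_eq_rdot[of ab w] by (simp add: inner_commute)
  qed
  then show ?thesis
    using that[of w] w by (simp add: persp_mu_def inner_prod_def)
qed

section \<open>Integration over the simplex, its cone and regions above the cone\<close>

lemma compact_simplex: "compact (convex hull V)"
  by (rule finite_imp_compact_convex_hull[OF finite_vertices])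

lemma borel_simplex_cone [measurable]: "simplex_cone \<in> sets borel"
  using closed_simplex_cone by simp

lemma borel_measurable_cone_weight:
  fixes G :: "(real^'n) \<times> real \<Rightarrow> real"
  assumes "G \<in> borel_measurable borel"
  shows "(\<lambda>w. ennreal (exp (- snd w) * G w) * indicator simplex_cone w) \<in> borel_measurable borel"
  using assms
  by (intro borel_measurable_times_ennreal borel_measurable_indicator borel_simplex_cone
      measurable_compose[OF _ measurable_ennreal] borel_measurable_times)
    (auto intro!: borel_measurable_continuous_onI continuous_intros)

lemma set_integrable_simplex:
  fixes g :: "real^'n \<Rightarrow> real"
  assumes "continuous_on (convex hull V) g"
  shows "set_integrable lborel (convex hull V) g"
  unfolding set_integrable_def by (rule borel_integrable_compact[OF compact_simplex assms])

lemma nn_integral_simplex: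
  fixes g :: "real^'n \<Rightarrow> real"
  assumes "continuous_on (convex hull V) g" "\<And>u. u \<in> convex hull V \<Longrightarrow> 0 \<le> g u"
  shows "(\<integral>\<^sup>+u. ennreal (g u) * indicator (convex hull V) u \<partial>lborel) =
    ennreal (LINT u:convex hull V|lborel. g u)"
proof -
  have "(\<integral>\<^sup>+u. ennreal (g u) * indicator (convex hull V) u \<partial>lborel) =
      (\<integral>\<^sup>+u. ennreal (indicator (convex hull V) u *\<^sub>R g u) \<partial>lborel)"
    by (rule nn_integral_cong) (simp add: indicator_def)
  also have "\<dots> = ennreal (LINT u:convex hull V|lborel. g u)"
    unfolding set_lebesgue_integral_def
    using set_integrable_simplex[OF assms(1)] assms(2)
    by (intro nn_integral_eq_integral) (auto simp: set_integrable_def indicator_def)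
  finally show ?thesis .
qed

text \<open>The slice at height \<open>z\<close> is the simplex scaled by \<open>z\<close>, whence
  the Jacobian \<open>z ^ CARD('n)\<close>.\<close>

lemma nn_integral_cone_slice:
  assumes h: "h \<in> borel_measurable borel" and z: "0 < z"
    and supp: "\<And>x. (x, z) \<notin> simplex_cone \<Longrightarrow> h x = 0"
  shows "(\<integral>\<^sup>+x. h x \<partial>lborel) =
    ennreal (z ^ CARD('n)) * (\<integral>\<^sup>+u. h (z *\<^sub>R u) * indicator (convex hull V) u \<partial>lborel)"
proof -
  have "h (z *\<^sub>R u) = h (z *\<^sub>R u) * indicator (convex hull V) u" for u
    using supp[of "z *\<^sub>R u"] in_simplex_cone_scaleR_iff[OF z, of u] by (simp add: indicator_def)
  then have "(\<integral>\<^sup>+u. h (0 + z *\<^sub>R u) \<partial>lborel) = (\<integral>\<^sup>+u. h (z *\<^sub>R u) * indicator (convex hull V) u \<partial>lborel)"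
    by (intro nn_integral_cong) simp
  then show ?thesis
    using nn_integral_lborel_affine[OF h, of z 0] z by simp
qed

text \<open>Homogeneity of degree \<open>m\<close> makes the slice at height \<open>z\<close>
  contribute \<open>z ^ (CARD('n) + m) * exp (- z)\<close> times the integral over the simplex, and
  the Gamma integral supplies the factorial. The single height \<open>z = 0\<close> is null.\<close>

lemma nn_integral_cone_exp:
  fixes G :: "(real^'n) \<times> real \<Rightarrow> real"
  assumes [measurable]: "G \<in> borel_measurable borel"
    and g: "continuous_on (convex hull V) g" "\<And>u. u \<in> convex hull V \<Longrightarrow> 0 \<le> g u"
    and hom: "\<And>u z. u \<in> convex hull V \<Longrightarrow> 0 < z \<Longrightarrow> G (z *\<^sub>R u, z) = z ^ m * g u"
  shows "(\<integral>\<^sup>+w. ennreal (exp (- snd w) * G w) * indicator simplex_cone w \<partial>lborel) =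
    ennreal (fact (CARD('n) + m) * (LINT u:convex hull V|lborel. g u))"
proof -
  let ?I = "LINT u:convex hull V|lborel. g u"
  have I_nonneg: "0 \<le> ?I"
    unfolding set_lebesgue_integral_def
    using g(2) by (intro integral_nonneg_AE AE_I2) (auto simp: indicator_def)
  have slice: "(\<integral>\<^sup>+x. ennreal (exp (- z) * G (x, z)) * indicator simplex_cone (x, z) \<partial>lborel) =
      ennreal (z ^ (CARD('n) + m) * exp (- z)) * indicator {0..} z * ennreal ?I" if "z \<noteq> 0" for z
  proof (cases "0 < z")
    case True
    have "(\<integral>\<^sup>+x. ennreal (exp (- z) * G (x, z)) * indicator simplex_cone (x, z) \<partial>lborel) =
      ennreal (z ^ CARD('n)) * (\<integral>\<^sup>+u. ennreal (exp (- z) * G (z *\<^sub>R u, z)) *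
         indicator simplex_cone (z *\<^sub>R u, z) * indicator (convex hull V) u \<partial>lborel)"
      by (rule nn_integral_cone_slice[OF _ True]) auto
    also have "(\<integral>\<^sup>+u. ennreal (exp (- z) * G (z *\<^sub>R u, z)) *
         indicator simplex_cone (z *\<^sub>R u, z) * indicator (convex hull V) u \<partial>lborel) =
       (\<integral>\<^sup>+u. ennreal (exp (- z) * z ^ m * g u) * indicator (convex hull V) u \<partial>lborel)"
      using hom True in_simplex_cone_scaleR_iff[OF True]
      by (intro nn_integral_cong) (auto simp: indicator_def mult.assoc)
    also have "\<dots> = ennreal (exp (- z) * z ^ m * ?I)"
      using g True by (subst nn_integral_simplex) (auto intro!: continuous_intros)
    finally show ?thesis
      using True I_nonneg by (simp add: ennreal_mult'[symmetric] power_add ac_simps)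
  next
    case False
    with that have "indicator simplex_cone (x, z) = (0::ennreal)" for x
      by (auto simp: simplex_cone_def indicator_def)
    with False that show ?thesis by simp
  qed
  have "(\<integral>\<^sup>+w. ennreal (exp (- snd w) * G w) * indicator simplex_cone w \<partial>lborel) =
      (\<integral>\<^sup>+z. (\<integral>\<^sup>+x. ennreal (exp (- z) * G (x, z)) * indicator simplex_cone (x, z) \<partial>lborel) \<partial>lborel)"
    unfolding lborel_prod[symmetric]
    using borel_measurable_cone_weight[of G]
    by (subst lborel_pair.nn_integral_snd[symmetric]) (simp_all add: lborel_prod)
  also have "\<dots> = (\<integral>\<^sup>+z. ennreal (z ^ (CARD('n) + m) * exp (- z)) * indicator {0..} z * ennreal ?I \<partial>lborel)"
    using AE_lborel_singleton[of "0::real"]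
    by (intro nn_integral_cong_AE) (auto simp: slice elim!: eventually_mono)
  also have "\<dots> = ennreal (fact (CARD('n) + m) * ?I)"
    using I_nonneg
    by (simp add: nn_integral_multc nn_intergal_power_times_exp_Ici ennreal_mult')
  finally show ?thesis .
qed

text \<open>The product of exponential densities is \<open>exp\<close> of minus the coordinate sum
  on the orthant, and \<open>cone_map\<close> turns the sum into the height and the orthant into the
  cone.\<close>

lemma nn_integral_exponential_cone_map:
  assumes [measurable]: "G \<in> borel_measurable borel"
  shows "(\<integral>\<^sup>+p. ennreal (exp (- snd (cone_map p)) * G (cone_map p)) *
      indicator simplex_cone (cone_map p) \<partial>lborel) =
    (\<integral>\<^sup>+p. ennreal (G (cone_map p)) \<partial>exponential_lborel)"
proof -
  have [measurable]: "cone_map \<in> borel_measurable borel"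
    using linear_cone_map
    by (intro borel_measurable_continuous_onI linear_continuous_on) (simp add: linear_conv_bounded_linear)
  have eq: "(\<Prod>b\<in>Basis. ennreal (exponential_density 1 (p \<bullet> b))) =
      ennreal (exp (- snd (cone_map p))) * indicator simplex_cone (cone_map p)" for p
  proof (cases "\<forall>b\<in>Basis. 0 \<le> p \<bullet> b")
    case True
    then have "(\<Prod>b\<in>Basis. ennreal (exponential_density 1 (p \<bullet> b))) =
        ennreal (\<Prod>b\<in>Basis. exp (- (p \<bullet> b)))"
      by (subst prod_ennreal[symmetric]) (auto intro!: prod.cong simp: exponential_density_def not_less)
    also have "(\<Prod>b\<in>Basis. exp (- (p \<bullet> b))) = exp (- snd (cone_map p))"
      by (simp add: cone_map_eq exp_sum sum_negf[symmetric])
    finally show ?thesis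
      using True by (simp add: cone_map_in_simplex_cone_iff)
  next
    case False
    then have "(\<Prod>b\<in>Basis. ennreal (exponential_density 1 (p \<bullet> b))) = 0"
      by (intro prod_zero) (auto simp: exponential_density_def not_le)
    with False show ?thesis
      by (simp add: cone_map_in_simplex_cone_iff)
  qed
  have "(\<integral>\<^sup>+p. ennreal (G (cone_map p)) \<partial>exponential_lborel) =
      (\<integral>\<^sup>+p. (\<Prod>b\<in>Basis. ennreal (exponential_density 1 (p \<bullet> b))) * ennreal (G (cone_map p)) \<partial>lborel)"
    unfolding exponential_lborel_def by (rule nn_integral_density) measurable
  then show ?thesis
    by (simp add: eq ennreal_mult' mult.assoc mult.commute[of "indicator _ _"])
qed

text \<open>One constant \<open>\<kappa>\<close> serves all integrands and degrees, so it drops out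
  when two such integrals are compared.\<close>

lemma simplex_moments:
  obtains \<kappa> :: real where "0 < \<kappa>"
    "\<And>G g m. G \<in> borel_measurable borel \<Longrightarrow> continuous_on (convex hull V) g \<Longrightarrow>
      (\<And>u. u \<in> convex hull V \<Longrightarrow> 0 \<le> g u) \<Longrightarrow>
      (\<And>u z. u \<in> convex hull V \<Longrightarrow> 0 < z \<Longrightarrow> G (z *\<^sub>R u, z) = z ^ m * g u) \<Longrightarrow>
      (\<integral>\<^sup>+p. ennreal (G (cone_map p)) \<partial>exponential_lborel) =
        ennreal (\<kappa> * (fact (CARD('n) + m) * (LINT u:convex hull V|lborel. g u)))"
proof -
  obtain \<kappa> where \<kappa>: "0 < \<kappa>" "\<And>g. g \<in> borel_measurable borel \<Longrightarrow>
      (\<integral>\<^sup>+p. g (cone_map p) \<partial>lborel) = ennreal \<kappa> * (\<integral>\<^sup>+y. g y \<partial>lborel)"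
    by (rule nn_integral_lborel_linear[OF linear_cone_map bij_cone_map]) blast
  show ?thesis
  proof (rule that[OF \<kappa>(1)])
    fix G :: "(real^'n) \<times> real \<Rightarrow> real" and g m
    assume [measurable]: "G \<in> borel_measurable borel" and g: "continuous_on (convex hull V) g"
      "\<And>u. u \<in> convex hull V \<Longrightarrow> 0 \<le> g u"
      "\<And>u z. u \<in> convex hull V \<Longrightarrow> 0 < z \<Longrightarrow> G (z *\<^sub>R u, z) = z ^ m * g u"
    have "(\<integral>\<^sup>+p. ennreal (G (cone_map p)) \<partial>exponential_lborel) =
        ennreal \<kappa> * (\<integral>\<^sup>+w. ennreal (exp (- snd w) * G w) * indicator simplex_cone w \<partial>lborel)"
      by (subst nn_integral_exponential_cone_map[symmetric], simp) (intro \<kappa>(2) borel_measurable_cone_weight, simp)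
    also have "\<dots> = ennreal (\<kappa> * (fact (CARD('n) + m) * (LINT u:convex hull V|lborel. g u)))"
      using \<kappa>(1) nn_integral_cone_exp[of G g m] g by (simp add: ennreal_mult')
    finally show "(\<integral>\<^sup>+p. ennreal (G (cone_map p)) \<partial>exponential_lborel) =
        ennreal (\<kappa> * (fact (CARD('n) + m) * (LINT u:convex hull V|lborel. g u)))" .
  qed
qed

text \<open>The slice at height \<open>z\<close> has volume \<open>z ^ CARD('n)\<close> times the
  integral of \<open>z * g u - z ^ m * f u\<close>, to be integrated over
  \<open>0 \<le> z \<le> 1\<close>. The naive relaxation has \<open>m = q\<close>, the perspective
  one \<open>m = 1\<close>. Points of \<open>S\<close> at the null height \<open>z = 0\<close> are
  left arbitrary, so a closure need not be determined there.\<close>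

lemma emeasure_cone_region:
  fixes S :: "((real^'n) \<times> real \<times> real) set"
  assumes [measurable]: "S \<in> sets borel"
    and neg: "\<And>x y z. (x, y, z) \<in> S \<Longrightarrow> 0 \<le> z"
    and pos: "\<And>x y z. 0 < z \<Longrightarrow>
      (x, y, z) \<in> S \<longleftrightarrow> z \<le> 1 \<and> (x, z) \<in> simplex_cone \<and> L x z \<le> y \<and> y \<le> U x z"
    and U: "\<And>u z. u \<in> convex hull V \<Longrightarrow> 0 < z \<Longrightarrow> U (z *\<^sub>R u) z = z * g u"
    and L: "\<And>u z. u \<in> convex hull V \<Longrightarrow> 0 < z \<Longrightarrow> L (z *\<^sub>R u) z = z ^ m * f u"
    and cont: "continuous_on (convex hull V) f" "continuous_on (convex hull V) g"
    and f: "\<And>u. u \<in> convex hull V \<Longrightarrow> 0 \<le> f u"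
    and fg: "\<And>u. u \<in> convex hull V \<Longrightarrow> f u \<le> g u"
    and m: "1 \<le> m"
  shows "emeasure lborel S = ennreal ((LINT u:convex hull V|lborel. g u) / (CARD('n) + 2)
    - (LINT u:convex hull V|lborel. f u) / (CARD('n) + m + 1))"
proof -
  let ?d = "CARD('n)"
  let ?If = "LINT u:convex hull V|lborel. f u" and ?Ig = "LINT u:convex hull V|lborel. g u"
  let ?D = "\<lambda>z. z ^ (?d + 1) * ?Ig - z ^ (?d + m) * ?If"
  have le: "z ^ m * f u \<le> z * g u" if "u \<in> convex hull V" "0 \<le> z" "z \<le> 1" for u z
  proof -
    have "z ^ m \<le> z ^ 1" using that m by (intro power_decreasing) auto
    then show ?thesis using that f fg by (intro mult_mono) auto
  qed
  have I: "(LINT u:convex hull V|lborel. z * g u - z ^ m * f u) = z * ?Ig - z ^ m * ?If" for z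
    using set_integrable_simplex[OF cont(1)] set_integrable_simplex[OF cont(2)]
    by (simp add: set_integral_diff)
  have D_nonneg: "0 \<le> ?D z" if "0 \<le> z" "z \<le> 1" for z
  proof -
    have "0 \<le> (LINT u:convex hull V|lborel. z * g u - z ^ m * f u)"
      unfolding set_lebesgue_integral_def
      using le that by (intro integral_nonneg_AE AE_I2) (auto simp: indicator_def)
    then have "0 \<le> z ^ ?d * (z * ?Ig - z ^ m * ?If)"
      unfolding I using that by simp
    then show ?thesis by (simp add: algebra_simps power_add)
  qed
  have slice: "(\<integral>\<^sup>+x. \<integral>\<^sup>+y. indicator S (x, y, z) \<partial>lborel \<partial>lborel) =
      ennreal (?D z) * indicator {0..1} z" if "z \<noteq> 0" for z
  proof (cases "0 < z \<and> z \<le> 1")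
    case True
    then have z: "0 < z" "z \<le> 1" by auto
    have inner: "(\<integral>\<^sup>+y. indicator S (x, y, z) \<partial>lborel) =
        (if (x, z) \<in> simplex_cone then emeasure lborel {L x z..U x z} else 0)" for x
    proof -
      have "(\<integral>\<^sup>+y. indicator S (x, y, z) \<partial>lborel) =
          (\<integral>\<^sup>+y. (if (x, z) \<in> simplex_cone then indicator {L x z..U x z} y else 0) \<partial>lborel)"
        using pos z by (intro nn_integral_cong) (auto simp: indicator_def)
      then show ?thesis by simp
    qed
    have "(\<integral>\<^sup>+x. \<integral>\<^sup>+y. indicator S (x, y, z) \<partial>lborel \<partial>lborel) =
        ennreal (z ^ ?d) * (\<integral>\<^sup>+u. (\<integral>\<^sup>+y. indicator S (z *\<^sub>R u, y, z) \<partial>lborel)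
          * indicator (convex hull V) u \<partial>lborel)"
    proof (rule nn_integral_cone_slice[OF _ z(1)])
      show "(\<lambda>x. \<integral>\<^sup>+y. indicator S (x, y, z) \<partial>lborel) \<in> borel_measurable borel"
        by measurable
    qed (simp add: inner)
    also have "(\<integral>\<^sup>+u. (\<integral>\<^sup>+y. indicator S (z *\<^sub>R u, y, z) \<partial>lborel) * indicator (convex hull V) u \<partial>lborel) =
        (\<integral>\<^sup>+u. ennreal (z * g u - z ^ m * f u) * indicator (convex hull V) u \<partial>lborel)"
      unfolding inner using in_simplex_cone_scaleR_iff[OF z(1)] z le
      by (intro nn_integral_cong) (auto simp: indicator_def U L)
    also have "\<dots> = ennreal (z * ?Ig - z ^ m * ?If)"
      using le z cont unfolding I[symmetric]
      by (intro nn_integral_simplex continuous_intros) auto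
    finally show ?thesis
      using z by (simp add: ennreal_mult'[symmetric] power_add algebra_simps)
  next
    case False
    have "(x, y, z) \<notin> S" for x y
      using False that neg[of x y z] pos[of z x y] by force
    then have "(\<integral>\<^sup>+x. \<integral>\<^sup>+y. indicator S (x, y, z) \<partial>lborel \<partial>lborel) = 0" by simp
    with False that show ?thesis by (auto simp: indicator_def)
  qed
  \<comment> \<open>Points have the form \<open>(x, y, z)\<close>; Fubini moves \<open>z\<close>
    outermost to reach the slices.\<close>
  have "emeasure lborel S = (\<integral>\<^sup>+w. indicator S w \<partial>(lborel \<Otimes>\<^sub>M lborel))"
    by (simp add: lborel_prod)
  also have "\<dots> = (\<integral>\<^sup>+x. \<integral>\<^sup>+p. indicator S (x, p) \<partial>lborel \<partial>lborel)"
    by (rule lborel.nn_integral_fst[symmetric]) (simp add: lborel_prod)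
  also have "\<dots> = (\<integral>\<^sup>+x. \<integral>\<^sup>+p. indicator S (x, p) \<partial>(lborel \<Otimes>\<^sub>M lborel) \<partial>lborel)"
    by (simp add: lborel_prod)
  also have "\<dots> = (\<integral>\<^sup>+x. \<integral>\<^sup>+z. \<integral>\<^sup>+y. indicator S (x, y, z) \<partial>lborel \<partial>lborel \<partial>lborel)"
    by (intro nn_integral_cong lborel_pair.nn_integral_snd[symmetric]) (simp add: lborel_prod)
  also have "\<dots> = (\<integral>\<^sup>+z. \<integral>\<^sup>+x. \<integral>\<^sup>+y. indicator S (x, y, z) \<partial>lborel \<partial>lborel \<partial>lborel)"
    by (rule lborel_pair.Fubini'[symmetric]) measurable
  also have "\<dots> = (\<integral>\<^sup>+z. ennreal (?D z) * indicator {0..1} z \<partial>lborel)"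
    using AE_lborel_singleton[of "0::real"]
    by (intro nn_integral_cong_AE) (auto simp: slice elim!: eventually_mono)
  also have "\<dots> = ennreal ((1 ^ (?d + 2) * ?Ig / (?d + 2) - 1 ^ (?d + m + 1) * ?If / (?d + m + 1)) -
      (0 ^ (?d + 2) * ?Ig / (?d + 2) - 0 ^ (?d + m + 1) * ?If / (?d + m + 1)))"
  proof (rule nn_integral_FTC_Icc)
    fix z :: real
    have P: "((\<lambda>z. z ^ Suc n * c / real (Suc n)) has_real_derivative z ^ n * c) (at z)" for n and c :: real
      by (auto intro!: derivative_eq_intros simp del: of_nat_Suc power_Suc)
    show "((\<lambda>z. z ^ (?d + 2) * ?Ig / (?d + 2) - z ^ (?d + m + 1) * ?If / (?d + m + 1))
        has_real_derivative ?D z) (at z)"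
      using DERIV_diff[OF P[of "?d + 1" ?Ig] P[of "?d + m" ?If]]
      by (simp add: numeral_2_eq_2 del: of_nat_Suc of_nat_add power_Suc)
  qed (use D_nonneg in auto)
  finally show ?thesis by simp
qed

section \<open>Volumes of the relaxations\<close>

text \<open>Jensen's inequality: \<open>u\<close> is the mean of the vertices under its barycentric
  weights \<open>p \<bullet> b\<close>, the even power is convex, and the interpolant is the
  weighted mean of the vertex values.\<close>

lemma power_le_persp_mu:
  assumes u: "u \<in> convex hull V" and q: "even q"
  shows "(c \<bullet> u) ^ q \<le> persp_mu (\<lambda>x. (c \<bullet> x) ^ q) V u 1"
proof -
  obtain w where w: "\<And>x z. persp_mu (\<lambda>x. (c \<bullet> x) ^ q) V x z = w \<bullet> (x, z)"
    "\<And>p. w \<bullet> cone_map p = (\<Sum>b\<in>Basis. (c \<bullet> \<beta> b) ^ q * (p \<bullet> b))"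
    by (rule persp_mu_eq_inner[of "\<lambda>x. (c \<bullet> x) ^ q"]) blast
  obtain p where p: "(u, 1) = cone_map p"
    using bij_is_surj[OF bij_cone_map] by blast
  have "(u, 1) \<in> simplex_cone"
    using in_simplex_cone_scaleR_iff[of 1 u] u by simp
  then have nonneg: "\<forall>b\<in>Basis. 0 \<le> p \<bullet> b"
    unfolding p cone_map_in_simplex_cone_iff .
  have *: "u = (\<Sum>b\<in>Basis. (p \<bullet> b) *\<^sub>R \<beta> b)" "(\<Sum>b\<in>Basis. p \<bullet> b) = 1"
    using p by (auto simp: cone_map_eq)
  have "(\<Sum>b\<in>Basis. (p \<bullet> b) *\<^sub>R (c \<bullet> \<beta> b)) ^ q \<le> (\<Sum>b\<in>Basis. (p \<bullet> b) * (c \<bullet> \<beta> b) ^ q)"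
    using nonneg *(2) by (intro convex_on_sum[OF _ _ convex_power_even[OF q]]) auto
  then show ?thesis
    unfolding w(1) p w(2) by (simp add: *(1) inner_sum_right mult.commute)
qed

text \<open>Moments of order \<open>q\<close> and 1 give
  \<open>\<kappa> * fact (d + q) * A = fact q * h\<close> and
  \<open>\<kappa> * fact (d + 1) * B = P\<close>, where \<open>h\<close> and \<open>P\<close> are
  the complete homogeneous polynomial and the power sum of degree \<open>q\<close> in the numbers
  \<open>c \<bullet> v\<close>. Hunter's inequality bounds \<open>P\<close> by
  \<open>2 ^ (q div 2) * fact (q div 2) * h\<close>, and \<open>\<kappa>\<close> cancels.\<close>

lemma simplex_integral_ratio:
  fixes c :: "real^'n"
  assumes c: "c \<noteq> 0" and q: "even q" "0 < q"
  defines "A \<equiv> LINT u:convex hull V|lborel. (c \<bullet> u) ^ q"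
    and "B \<equiv> LINT u:convex hull V|lborel. persp_mu (\<lambda>x. (c \<bullet> x) ^ q) V u 1"
  shows "0 < A" "real (q + CARD('n) + 1) * B \<le>
      (real (fact (q + CARD('n) + 1)) / (real (fact q) * real (fact (CARD('n) + 1)))
        * 2 ^ (q div 2) * real (fact (q div 2))) * A"
proof -
  let ?d = "CARD('n)"
  obtain w where w: "\<And>x z. persp_mu (\<lambda>x. (c \<bullet> x) ^ q) V x z = w \<bullet> (x, z)"
    "\<And>p. w \<bullet> cone_map p = (\<Sum>b\<in>Basis. (c \<bullet> \<beta> b) ^ q * (p \<bullet> b))"
    by (rule persp_mu_eq_inner[of "\<lambda>x. (c \<bullet> x) ^ q"]) blast
  obtain \<kappa> where \<kappa>: "0 < \<kappa>"
    "\<And>G g m. G \<in> borel_measurable borel \<Longrightarrow> continuous_on (convex hull V) g \<Longrightarrow>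
      (\<And>u. u \<in> convex hull V \<Longrightarrow> 0 \<le> g u) \<Longrightarrow>
      (\<And>u z. u \<in> convex hull V \<Longrightarrow> 0 < z \<Longrightarrow> G (z *\<^sub>R u, z) = z ^ m * g u) \<Longrightarrow>
      (\<integral>\<^sup>+p. ennreal (G (cone_map p)) \<partial>exponential_lborel) =
        ennreal (\<kappa> * (fact (CARD('n) + m) * (LINT u:convex hull V|lborel. g u)))"
    by (rule simplex_moments) blast
  obtain bs :: "((real^'n) \<times> real) list" where bs: "set bs = Basis" "distinct bs"
    using finite_distinct_list[OF finite_Basis] by blast
  let ?a = "\<lambda>b. c \<bullet> \<beta> b"
  let ?H = "chs (map ?a bs) q" and ?P = "\<Sum>b\<in>Basis. ?a b ^ q" and ?N = "\<Sum>b\<in>Basis. (?a b)\<^sup>2"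
  let ?k = "q div 2"
  have k: "q = 2 * ?k" "0 < ?k" using q by auto
  have mu_nonneg: "0 \<le> persp_mu (\<lambda>x. (c \<bullet> x) ^ q) V u 1" if "u \<in> convex hull V" for u
    using power_le_persp_mu[OF that q(1), of c] zero_le_even_power[OF q(1), of "c \<bullet> u"] by linarith
  have A_nonneg: "0 \<le> A"
    unfolding A_def set_lebesgue_integral_def using q(1)
    by (intro integral_nonneg_AE AE_I2) (auto simp: indicator_def zero_le_even_power)
  have B_nonneg: "0 \<le> B"
    unfolding B_def set_lebesgue_integral_def using mu_nonneg
    by (intro integral_nonneg_AE AE_I2) (auto simp: indicator_def)

  have "?N ^ ?k / (2 ^ ?k * fact ?k) \<le> ?H"
    using hunter[of "map ?a bs" ?k] k(1) bs
    by (simp add: o_def sum_list_distinct_conv_sum_set)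
  then have N_le: "?N ^ ?k \<le> 2 ^ ?k * fact ?k * ?H"
    by (simp add: field_simps)
  have "?P = (\<Sum>b\<in>Basis. ((?a b)\<^sup>2) ^ ?k)"
    by (subst k(1)) (simp only: power_mult)
  also have "\<dots> \<le> ?N ^ ?k"
    using k(2) by (intro sum_power_le_power_sum) auto
  finally have P_le: "?P \<le> 2 ^ ?k * fact ?k * ?H"
    using N_le by linarith
  \<comment> \<open>If \<open>c\<close> were orthogonal to all vertices, \<open>(c, 0)\<close> would
    be orthogonal to the range of \<open>cone_map\<close>, which is the whole space and contains
    \<open>(c, 0)\<close> itself.\<close>
  have "\<exists>b\<in>Basis. ?a b \<noteq> 0"
  proof (rule ccontr)
    assume "\<not> ?thesis"
    then have "(c, 0) \<bullet> cone_map p = 0" for p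
      by (simp add: cone_map_eq inner_sum_right)
    then have "(c, 0::real) \<bullet> (c, 0) = 0"
      using surjD[OF bij_is_surj[OF bij_cone_map], of "(c, 0)"] by metis
    with c show False by simp
  qed
  then have "0 < ?N"
    by (auto intro!: sum_pos2)
  then have "0 < 2 ^ ?k * fact ?k * ?H"
    using N_le by (intro less_le_trans[OF _ N_le]) simp
  then have H: "0 < ?H"
    by (rule zero_less_mult_pos) simp

  have "(\<integral>\<^sup>+p. ennreal ((\<lambda>w. (c \<bullet> fst w) ^ q) (cone_map p)) \<partial>exponential_lborel) =
      ennreal (\<kappa> * (fact (?d + q) * A))"
    unfolding A_def using q(1)
    by (intro \<kappa>(2)) (auto intro!: borel_measurable_continuous_onI continuous_intros
        simp: power_mult_distrib zero_le_even_power)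
  moreover have "(\<integral>\<^sup>+p. ennreal ((\<Sum>b\<in>Basis. ?a b * (p \<bullet> b)) ^ q) \<partial>exponential_lborel) =
      ennreal (fact q * ?H)"
    using bs q(1) by (intro nn_integral_exponential_lborel_power) (auto simp: zero_le_even_power)
  ultimately have "ennreal (\<kappa> * (fact (?d + q) * A)) = ennreal (fact q * ?H)"
    by (simp add: cone_map_eq inner_sum_right mult.commute)
  then have eqA: "\<kappa> * (fact (?d + q) * A) = fact q * ?H"
    using \<kappa>(1) A_nonneg H by (subst (asm) ennreal_inj) auto

  have "(\<integral>\<^sup>+p. ennreal ((\<lambda>y. w \<bullet> y) (cone_map p)) \<partial>exponential_lborel) =
      ennreal (\<kappa> * (fact (?d + 1) * B))"
    unfolding B_def
  proof (rule \<kappa>(2))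
    show "w \<bullet> (z *\<^sub>R u, z) = z ^ 1 * persp_mu (\<lambda>x. (c \<bullet> x) ^ q) V u 1" for u z
      by (simp add: w(1) inner_prod_def algebra_simps)
  qed (use mu_nonneg in \<open>auto simp: w(1) intro!: borel_measurable_continuous_onI continuous_intros\<close>)
  \<comment> \<open>The moment formula is reused with order 1 and coefficients
    \<open>?a b ^ q\<close>; in degree 1 \<open>chs\<close> is the plain sum.\<close>
  moreover have "(\<integral>\<^sup>+p. ennreal ((\<Sum>b\<in>Basis. ?a b ^ q * (p \<bullet> b)) ^ 1) \<partial>exponential_lborel) =
      ennreal (fact 1 * chs (map (\<lambda>b. ?a b ^ q) bs) 1)"
    using bs q(1)
    by (intro nn_integral_exponential_lborel_power) (auto simp: zero_le_even_power intro!: sum_nonneg)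
  moreover have "chs (map (\<lambda>b. ?a b ^ q) bs) 1 = ?P"
    using bs by (simp add: chs_1 sum_list_distinct_conv_sum_set)
  ultimately have "ennreal (\<kappa> * (fact (?d + 1) * B)) = ennreal ?P"
    by (simp add: w(2))
  then have eqB: "\<kappa> * (fact (?d + 1) * B) = ?P"
    using \<kappa>(1) B_nonneg q(1)
    by (subst (asm) ennreal_inj) (auto intro!: sum_nonneg simp: zero_le_even_power)

  have "0 < \<kappa> * (fact (?d + q) * A)"
    unfolding eqA using H by simp
  then show "0 < A"
    using \<kappa>(1) by (simp add: zero_less_mult_iff)

  have fact_eq: "fact (q + ?d + 1) = real (q + ?d + 1) * fact (?d + q)"
    by (simp add: add.commute[of ?d])
  have "\<kappa> * fact (?d + 1) * B \<le> 2 ^ ?k * fact ?k * ?H"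
    using P_le eqB by (simp add: mult.assoc)
  also have "?H = \<kappa> * (fact (?d + q) * A) / fact q"
    unfolding eqA by simp
  finally have "\<kappa> * (fact (?d + 1) * B) \<le> \<kappa> * (2 ^ ?k * fact ?k * (fact (?d + q) * A / fact q))"
    by (simp add: mult_ac)
  then have "fact (?d + 1) * B \<le> 2 ^ ?k * fact ?k * (fact (?d + q) * A / fact q)"
    using \<kappa>(1) by (simp only: mult_le_cancel_left_pos)
  then have "B \<le> 2 ^ ?k * fact ?k * (fact (?d + q) * A / fact q) / fact (?d + 1)"
    by (simp only: pos_le_divide_eq[OF fact_gt_zero] mult.commute)
  then have "real (q + ?d + 1) * B \<le>
      real (q + ?d + 1) * (2 ^ ?k * fact ?k * (fact (?d + q) * A / fact q) / fact (?d + 1))"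
    by (intro mult_left_mono) auto
  also have "\<dots> = (real (fact (q + ?d + 1)) / (real (fact q) * real (fact (?d + 1)))
        * 2 ^ ?k * real (fact ?k)) * A"
    unfolding of_nat_fact fact_eq by (simp only: times_divide_eq_left times_divide_eq_right divide_divide_eq_left mult_ac)
  finally show "real (q + ?d + 1) * B \<le> (real (fact (q + ?d + 1)) / (real (fact q) * real (fact (?d + 1)))
        * 2 ^ ?k * real (fact ?k)) * A" .
qed

lemma measure_lebesgue_cone_region:
  fixes S :: "((real^'n) \<times> real \<times> real) set"
  assumes S: "closed S" "\<And>x y z. (x, y, z) \<in> S \<Longrightarrow> 0 \<le> z"
    "\<And>x y z. 0 < z \<Longrightarrow> (x, y, z) \<in> S \<longleftrightarrow>
      z \<le> 1 \<and> (x, z) \<in> simplex_cone \<and> L x z \<le> y \<and> y \<le> persp_mu (\<lambda>x. (c \<bullet> x) ^ q) V x z"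
    and L: "\<And>u z. u \<in> convex hull V \<Longrightarrow> 0 < z \<Longrightarrow> L (z *\<^sub>R u) z = z ^ m * (c \<bullet> u) ^ q"
    and q: "even q" and m: "1 \<le> m"
  shows "measure lebesgue S =
    (LINT u:convex hull V|lborel. persp_mu (\<lambda>x. (c \<bullet> x) ^ q) V u 1) / (CARD('n) + 2)
    - (LINT u:convex hull V|lborel. (c \<bullet> u) ^ q) / (CARD('n) + m + 1)"
    (is "_ = ?B / _ - ?A / _")
proof -
  obtain w where w: "\<And>x z. persp_mu (\<lambda>x. (c \<bullet> x) ^ q) V x z = w \<bullet> (x, z)"
    by (rule persp_mu_eq_inner[of "\<lambda>x. (c \<bullet> x) ^ q"]) blast
  have cont: "continuous_on (convex hull V) (\<lambda>u. (c \<bullet> u) ^ q)"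
    "continuous_on (convex hull V) (\<lambda>u. persp_mu (\<lambda>x. (c \<bullet> x) ^ q) V u 1)"
    by (auto simp: w intro!: continuous_intros)
  have em: "emeasure lborel S = ennreal (?B / (CARD('n) + 2) - ?A / (CARD('n) + m + 1))"
  proof (rule emeasure_cone_region[where U="persp_mu (\<lambda>x. (c \<bullet> x) ^ q) V" and L=L])
    show "persp_mu (\<lambda>x. (c \<bullet> x) ^ q) V (z *\<^sub>R u) z = z * persp_mu (\<lambda>x. (c \<bullet> x) ^ q) V u 1" for u z
      by (simp add: w inner_prod_def algebra_simps)
  qed (use S L q m cont power_le_persp_mu in \<open>auto simp: zero_le_even_power\<close>)
  have A: "0 \<le> ?A"
    unfolding set_lebesgue_integral_def using q
    by (intro integral_nonneg_AE AE_I2) (auto simp: indicator_def zero_le_even_power)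
  \<comment> \<open>This keeps the difference nonnegative, so that \<open>ennreal\<close> does not
    truncate it and the real measure can be read off.\<close>
  have "?A \<le> ?B"
    by (intro set_integral_mono set_integrable_simplex cont power_le_persp_mu q)
  then have "?A / (CARD('n) + m + 1) \<le> ?B / (CARD('n) + 2)"
    using A m by (intro frac_le) auto
  moreover have "measure lebesgue S = measure lborel S"
    using S(1) by (simp add: measure_completion)
  ultimately show ?thesis
    by (simp add: measure_def em)
qed

section \<open>The two relaxations as closed regions above the cone\<close>

lemma closed_cone_preimage:
  "closed {t :: (real^'n) \<times> real \<times> real. (fst t, snd (snd t)) \<in> simplex_cone}"
  using closed_vimage[OF closed_simplex_cone, of "\<lambda>t :: (real^'n) \<times> real \<times> real. (fst t, snd (snd t))"]
  by (simp add: vimage_def continuous_on_Pair continuous_on_fst continuous_on_snd)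

lemma closed_below_persp_mu:
  "closed {t. fst (snd t) \<le> persp_mu f V (fst t) (snd (snd t))}"
  unfolding persp_mu_def by (intro closed_Collect_le continuous_intros)

lemma measure_naive_relax:
  assumes q: "even q" "0 < q"
  shows "measure lebesgue (naive_relax (\<lambda>x. (c \<bullet> x) ^ q) V (convex hull V)) =
    (LINT u:convex hull V|lborel. persp_mu (\<lambda>x. (c \<bullet> x) ^ q) V u 1) / (CARD('n) + 2)
    - (LINT u:convex hull V|lborel. (c \<bullet> u) ^ q) / (CARD('n) + q + 1)"
proof (rule measure_lebesgue_cone_region)
  have "naive_relax (\<lambda>x. (c \<bullet> x) ^ q) V (convex hull V) =
      {t. fst (snd t) \<le> persp_mu (\<lambda>x. (c \<bullet> x) ^ q) V (fst t) (snd (snd t))} \<inter>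
      {t. (c \<bullet> fst t) ^ q \<le> fst (snd t)} \<inter>
      {t. (fst t, snd (snd t)) \<in> simplex_cone} \<inter> {t. snd (snd t) \<le> 1}"
    by (auto simp: naive_relax_def simplex_cone_def)
  also have "closed \<dots>"
    by (intro closed_Int closed_below_persp_mu closed_cone_preimage closed_Collect_le continuous_intros)
  finally show "closed (naive_relax (\<lambda>x. (c \<bullet> x) ^ q) V (convex hull V))" .
qed (use q in \<open>auto simp: naive_relax_def simplex_cone_def power_mult_distrib\<close>)

lemma measure_persp_relax:
  assumes q: "even q" "0 < q"
  shows "measure lebesgue (persp_relax (\<lambda>x. (c \<bullet> x) ^ q) V (convex hull V)) =
    (LINT u:convex hull V|lborel. persp_mu (\<lambda>x. (c \<bullet> x) ^ q) V u 1) / (CARD('n) + 2)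
    - (LINT u:convex hull V|lborel. (c \<bullet> u) ^ q) / (CARD('n) + 1 + 1)"
proof -
  let ?f = "\<lambda>x. (c \<bullet> x) ^ q"
  let ?R = "{(x, y, z). persp_mu ?f V x z \<ge> y \<and> y \<ge> z * ?f ((1 / z) *\<^sub>R x)
      \<and> x \<in> scale_set z (convex hull V) \<and> 0 < z \<and> z \<le> 1}"
  \<comment> \<open>For \<open>z > 0\<close> the perspective inequality is multiplied by
    \<open>z ^ (q - 1)\<close>. The result is polynomial and defines a closed set, so taking the
    closure adds points at \<open>z = 0\<close> only.\<close>
  let ?C = "{t. fst (snd t) \<le> persp_mu ?f V (fst t) (snd (snd t))} \<inter>
      {t. (c \<bullet> fst t) ^ q \<le> fst (snd t) * snd (snd t) ^ (q - 1)} \<inter>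
      {t. (fst t, snd (snd t)) \<in> simplex_cone} \<inter> {t. snd (snd t) \<le> 1}"
  have f_persp: "z * ?f ((1 / z) *\<^sub>R x) = ?f x / z ^ (q - 1)" if "0 < z" for x z
    using that q(2) by (cases q) (simp_all add: power_divide)
  have R_iff: "(x, y, z) \<in> ?R \<longleftrightarrow> (x, y, z) \<in> ?C" if "0 < z" for x y z
    using that f_persp[OF that, of x] by (simp add: simplex_cone_def pos_divide_le_eq)
  have "closed ?C"
    by (intro closed_Int closed_below_persp_mu closed_cone_preimage closed_Collect_le continuous_intros)
  moreover have "?R \<subseteq> ?C"
  proof
    fix t assume t: "t \<in> ?R"
    obtain x y z where xyz: "t = (x, y, z)" by (cases t)
    then have "0 < z" using t by simp
    then show "t \<in> ?C" using R_iff t unfolding xyz by blast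
  qed
  ultimately have sub: "closure ?R \<subseteq> ?C" by (rule closure_minimal[rotated])
  have cl: "(x, y, z) \<in> closure ?R \<longleftrightarrow> (x, y, z) \<in> ?R" if "0 < z" for x y z
    using sub R_iff[OF that, of x y] closure_subset[of ?R] by blast
  show ?thesis
    unfolding persp_relax_def
  \<comment> \<open>At \<open>(z u, z)\<close> the lower bound is \<open>z\<close> times the value
    at \<open>u\<close>, so here \<open>m = 1\<close>.\<close>
  proof (rule measure_lebesgue_cone_region[where L="\<lambda>x z. z * ?f ((1 / z) *\<^sub>R x)"])
    show "0 \<le> z" if "(x, y, z) \<in> closure ?R" for x y z
      using sub that by (auto simp: simplex_cone_def)
    show "(x, y, z) \<in> closure ?R \<longleftrightarrow>
        z \<le> 1 \<and> (x, z) \<in> simplex_cone \<and> z * ?f ((1 / z) *\<^sub>R x) \<le> y \<and> y \<le> persp_mu ?f V x z"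
      if "0 < z" for x y z
      unfolding cl[OF that] using that by (auto simp: simplex_cone_def)
  qed (use q in auto)
qed

end

text \<open>Over a common denominator the relative gap is \<open>A * (q - 1) / E\<close> with
  \<open>E = (q + d + 1) * B - (d + 2) * A\<close>, and \<open>X\<close> bounds \<open>E\<close> by
  \<open>(X - (d + 2)) * A\<close>. Positivity of \<open>E\<close> and \<open>A\<close> also makes
  the denominator of the bound positive.\<close>

lemma relative_gap_bound:
  fixes A B X :: real and d q :: nat
  assumes A: "0 < A" and AB: "A \<le> B" and X: "real (q + d + 1) * B \<le> X * A" and q: "2 \<le> q"
  shows "(real q - 1) / (X - real (d + 2)) \<le>
    ((B / (d + 2) - A / (d + q + 1)) - (B / (d + 2) - A / (d + 1 + 1))) / (B / (d + 2) - A / (d + q + 1))"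
proof -
  let ?E = "real (q + d + 1) * B - real (d + 2) * A"
  have E: "0 < ?E"
  proof -
    have "real (d + 2) * A < real (q + d + 1) * A" using A q by simp
    also have "\<dots> \<le> real (q + d + 1) * B" using AB by (intro mult_left_mono) auto
    finally show ?thesis by simp
  qed
  have EX: "?E \<le> (X - real (d + 2)) * A" using X by (simp add: algebra_simps)
  with E A have Xpos: "0 < X - real (d + 2)"
    by (metis less_le_trans zero_less_mult_pos2)
  define s t where "s = real (d + 2)" and "t = real (d + q + 1)"
  have st: "0 < s" "0 < t" "t - s = real q - 1" "?E = t * B - s * A"
    by (auto simp: s_def t_def add_ac)
  have "(B / s - A / t) - (B / s - A / s) = A * (t - s) / (s * t)" "B / s - A / t = (t * B - s * A) / (s * t)"
    using st(1,2) by (simp_all add: field_simps)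
  then have eq: "((B / s - A / t) - (B / s - A / s)) / (B / s - A / t) = A * (real q - 1) / ?E"
    using st by simp
  have "(real q - 1) / (X - real (d + 2)) = A * (real q - 1) / ((X - real (d + 2)) * A)"
    using A by simp
  also have "\<dots> \<le> A * (real q - 1) / ?E"
    using A q E EX by (intro divide_left_mono mult_nonneg_nonneg mult_pos_pos Xpos) auto
  finally show ?thesis
    using eq by (simp add: s_def t_def)
qed

theorem theorem12:
  fixes V :: "(real^'n) set" and J :: "(real^'n) set" and c :: "real^'n" and q :: nat
  assumes "finite V" and "card V = CARD('n) + 1" and "\<not> affine_dependent V"
    and "J = convex hull V"
    and "J \<subseteq> {x. \<forall>i. 0 \<le> x $ i} - {0}"
    and "c \<noteq> 0" and "even q" and "q > 0"
  shows "let f = (\<lambda>x. (c \<bullet> x) ^ q); d = CARD('n) in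
    (measure lebesgue (naive_relax f V J) - measure lebesgue (persp_relax f V J))
      / measure lebesgue (naive_relax f V J)
    \<ge> (real q - 1) /
      (real (fact (q + d + 1)) / (real (fact q) * real (fact (d + 1)))
        * 2 ^ (q div 2) * real (fact (q div 2)) - real (d + 2))"
proof -
  \<comment> \<open>The \<open>d + 1\<close> vertices are matched with the basis of the space of
    dimension \<open>d + 1\<close>.\<close>
  have "card (Basis :: ((real^'n) \<times> real) set) = card V"
    using assms(2) by simp
  then obtain \<beta> :: "(real^'n) \<times> real \<Rightarrow> real^'n" where "bij_betw \<beta> Basis V"
    using finite_same_card_bij[OF finite_Basis assms(1)] by blast
  then interpret simplex_vertices V \<beta>
    using assms(3) by unfold_locales
  let ?f = "\<lambda>x. (c \<bullet> x) ^ q"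
  let ?A = "LINT u:convex hull V|lborel. ?f u" and ?B = "LINT u:convex hull V|lborel. persp_mu ?f V u 1"
  obtain w where w: "\<And>x z. persp_mu ?f V x z = w \<bullet> (x, z)"
    by (rule persp_mu_eq_inner[of ?f]) blast
  have "?A \<le> ?B"
    using assms(7)
    by (intro set_integral_mono set_integrable_simplex power_le_persp_mu)
      (auto simp: w intro!: continuous_intros)
  moreover have "2 \<le> q" using assms(7,8) by (auto elim: evenE)
  ultimately show ?thesis
    unfolding Let_def assms(4) measure_naive_relax[OF assms(7,8)] measure_persp_relax[OF assms(7,8)]
    by (intro relative_gap_bound simplex_integral_ratio assms(6-8))
qed

end
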